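(* Let $G$ be a finite simple connected graph with at least one edge and let $n\ge 2$ be an integer. Then the ideal $I(G)^n$ is bridge-friendly if and only if one of the following holds: (1) $G$ is an edge (two vertices joined by an edge) or a path of length $2$ (three vertices, two edges); or (2) $n\in\{2,3\}$ and $G$ is a triangle $C_3$.
   Context: Let $\Bbbk$ be a field. For a graph $G=(V,E)$ let $S=\Bbbk[V]$ be the polynomial ring whose variables are the vertices of $G$; the edge ideal is $I(G)=\langle xy : \{x,y\}\in E\rangle\subseteq S$. Bridge-friendly ideals. For a monomial ideal $I$ let $\mathrm{Gens}(I)$ be its set of minimal monomial generators, with a fixed total order $(\succ)$; $m$ dominates $m'$ if $m\succ m'$. For $\sigma\subseteq\mathrm{Gens}(I)$ and $m\in\mathrm{Gens}(I)$ with $\mathrm{lcm}(\sigma\cup\{m\})=\mathrm{lcm}(\sigma\setminus\{m\})$, $m$ is a bridge of $\sigma$ if $m\in\sigma$ and a gap of $\sigma$ if $m\notin\sigma$. Let $\mathrm{sb}(\sigma)$ be the smallest bridge of $\sigma$ with respect to $(\succ)$ if $\sigma$ has a bridge (and $\emptyset$ otherwise). A gap $m$ of $\sigma$ is a true gap of $\sigma$ if every bridge $m'$ of $\sigma\cup\{m\}$ with $m\succ m'$ is already a bridge of $\sigma$. The set $\sigma$ is potentially-type-2 if it has a bridge not dominating any of its true gaps. It is type-2 if it is potentially-type-2 and, whenever $\sigma'\neq\sigma$ is another potentially-type-2 set with $\sigma'\setminus\{\mathrm{sb}(\sigma')\}=\sigma\setminus\{\mathrm{sb}(\sigma)\}$,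 one has $\mathrm{sb}(\sigma')\succ\mathrm{sb}(\sigma)$. The ideal $I$ is bridge-friendly with respect to $(\succ)$ if all potentially-type-2 subsets of $\mathrm{Gens}(I)$ are type-2; $I$ is bridge-friendly if it is so with respect to some total order on $\mathrm{Gens}(I)$. *)

theory Defs
  imports "HOL.Modules" "HOL-Library.Poly_Mapping"
begin

section \<open>Polynomial rings, ideals and edge ideals\<close>

text \<open>
  A monomial is represented by its exponent vector. The variables are the elements of the type
  \<open>'v\<close>; for a finite type \<open>'v\<close> and a field \<open>'k\<close>, the type \<open>('v, 'k) mpoly\<close> with its type-class
  ring structure is the polynomial ring \<open>'k['v]\<close>. The type-class order on
  \<open>'v monomial\<close> (lexicographic) is not divisibility and plays no role here.
\<close>

type_synonym 'v monomial = "'v \<Rightarrow>\<^sub>0 nat"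
type_synonym ('v, 'k) mpoly = "('v \<Rightarrow>\<^sub>0 nat) \<Rightarrow>\<^sub>0 'k"

definition mono_poly :: "'v monomial \<Rightarrow> ('v, 'k::comm_ring_1) mpoly" where
  "mono_poly m = Poly_Mapping.single m 1"

definition Var :: "'v \<Rightarrow> ('v, 'k::comm_ring_1) mpoly" where
  "Var v = mono_poly (Poly_Mapping.single v 1)"

text \<open>A commutative ring is a module over itself, whose submodules are the ideals.\<close>

abbreviation ideal_of :: "'a::comm_ring_1 set \<Rightarrow> 'a set" where
  "ideal_of B \<equiv> module.span (*) B"

primrec ideal_power :: "'a::comm_ring_1 set \<Rightarrow> nat \<Rightarrow> 'a set" where
  "ideal_power I 0 = UNIV"
| "ideal_power I (Suc n) = ideal_of {a * b | a b. a \<in> I \<and> b \<in> ideal_power I n}"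

definition edge_ideal :: "'v set set \<Rightarrow> ('v, 'k::field) mpoly set" where
  "edge_ideal E = ideal_of {Var x * Var y | x y. {x, y} \<in> E}"

definition is_min_mono_gens :: "('v, 'k::field) mpoly set \<Rightarrow> 'v monomial set \<Rightarrow> bool" where
  "is_min_mono_gens I B \<longleftrightarrow>
     ideal_of (mono_poly ` B) = I \<and> (\<forall>B'. B' \<subset> B \<longrightarrow> ideal_of (mono_poly ` B') \<noteq> I)"

text \<open>Well defined for monomial ideals, by lemma \<open>Gens_monomial_ideal\<close> below.\<close>

definition Gens :: "('v, 'k::field) mpoly set \<Rightarrow> 'v monomial set" where
  "Gens I = (THE B. is_min_mono_gens I B)"

definition mono_lcm :: "'v::finite monomial set \<Rightarrow> 'v monomial" where
  "mono_lcm \<sigma> = Abs_poly_mapping (\<lambda>v. Max (insert 0 ((\<lambda>m. Poly_Mapping.lookup m v) ` \<sigma>)))"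


section \<open>Bridge-friendly ideals\<close>

text \<open>
  Throughout, \<open>M\<close> is the set of minimal generators and \<open>(m, m') \<in> r\<close> stands for \<open>m \<succ> m'\<close>, i.e.
  \<open>m\<close> dominates \<open>m'\<close>, where \<open>r\<close> is a strict total order on \<open>M\<close>.
\<close>

definition is_bridge :: "'v::finite monomial set \<Rightarrow> 'v monomial set \<Rightarrow> 'v monomial \<Rightarrow> bool" where
  "is_bridge M \<sigma> m \<longleftrightarrow> m \<in> M \<and> mono_lcm (\<sigma> \<union> {m}) = mono_lcm (\<sigma> - {m}) \<and> m \<in> \<sigma>"

definition is_gap :: "'v::finite monomial set \<Rightarrow> 'v monomial set \<Rightarrow> 'v monomial \<Rightarrow> bool" where
  "is_gap M \<sigma> m \<longleftrightarrow> m \<in> M \<and> mono_lcm (\<sigma> \<union> {m}) = mono_lcm (\<sigma> - {m}) \<and> m \<notin> \<sigma>"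

definition smallest_bridge ::
    "'v::finite monomial set \<Rightarrow> 'v monomial rel \<Rightarrow> 'v monomial set \<Rightarrow> 'v monomial option" where
  "smallest_bridge M r \<sigma> =
     (if \<exists>m. is_bridge M \<sigma> m
      then Some (THE m. is_bridge M \<sigma> m \<and> (\<forall>m'. is_bridge M \<sigma> m' \<and> m' \<noteq> m \<longrightarrow> (m', m) \<in> r))
      else None)"

definition is_true_gap ::
    "'v::finite monomial set \<Rightarrow> 'v monomial rel \<Rightarrow> 'v monomial set \<Rightarrow> 'v monomial \<Rightarrow> bool" where
  "is_true_gap M r \<sigma> m \<longleftrightarrow>
     is_gap M \<sigma> m \<and>
     (\<forall>m'. is_bridge M (\<sigma> \<union> {m}) m' \<and> (m, m') \<in> r \<longrightarrow> is_bridge M \<sigma> m')"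

definition potentially_type2 ::
    "'v::finite monomial set \<Rightarrow> 'v monomial rel \<Rightarrow> 'v monomial set \<Rightarrow> bool" where
  "potentially_type2 M r \<sigma> \<longleftrightarrow>
     \<sigma> \<subseteq> M \<and> (\<exists>m. is_bridge M \<sigma> m \<and> (\<forall>g. is_true_gap M r \<sigma> g \<longrightarrow> (m, g) \<notin> r))"

text \<open>
  A potentially-type-2 set has a bridge, so its smallest bridge is never \<open>None\<close>.
\<close>

definition type2 ::
    "'v::finite monomial set \<Rightarrow> 'v monomial rel \<Rightarrow> 'v monomial set \<Rightarrow> bool" where
  "type2 M r \<sigma> \<longleftrightarrow>
     potentially_type2 M r \<sigma> \<and>
     (\<forall>\<sigma>'. potentially_type2 M r \<sigma>' \<and> \<sigma>' \<noteq> \<sigma> \<and>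
           \<sigma>' - set_option (smallest_bridge M r \<sigma>') = \<sigma> - set_option (smallest_bridge M r \<sigma>)
        \<longrightarrow> (the (smallest_bridge M r \<sigma>'), the (smallest_bridge M r \<sigma>)) \<in> r)"

definition bridge_friendly_wrt ::
    "('v::finite, 'k::field) mpoly set \<Rightarrow> 'v monomial rel \<Rightarrow> bool" where
  "bridge_friendly_wrt I r \<longleftrightarrow>
     (\<forall>\<sigma> \<subseteq> Gens I. potentially_type2 (Gens I) r \<sigma> \<longrightarrow> type2 (Gens I) r \<sigma>)"

definition bridge_friendly :: "('v::finite, 'k::field) mpoly set \<Rightarrow> bool" where
  "bridge_friendly I \<longleftrightarrow>
     (\<exists>r. strict_linear_order_on (Gens I) r \<and> bridge_friendly_wrt I r)"


section \<open>Graphs\<close>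

text \<open>
  A finite simple graph has the elements of a finite type \<open>'v\<close> as its vertices and is given by its
  set of edges.
\<close>

definition simple_graph :: "'v::finite set set \<Rightarrow> bool" where
  "simple_graph E \<longleftrightarrow> (\<forall>e\<in>E. card e = 2)"

definition connected_graph :: "'v::finite set set \<Rightarrow> bool" where
  "connected_graph E \<longleftrightarrow> (\<forall>u v. (u, v) \<in> {(x, y). {x, y} \<in> E}\<^sup>*)"

definition is_edge_graph :: "'v::finite set set \<Rightarrow> bool" where
  "is_edge_graph E \<longleftrightarrow> (\<exists>a b. distinct [a, b] \<and> UNIV = {a, b} \<and> E = {{a, b}})"

definition is_path_length2 :: "'v::finite set set \<Rightarrow> bool" where
  "is_path_length2 E \<longleftrightarrow>
     (\<exists>a b c. distinct [a, b, c] \<and> UNIV = {a, b, c} \<and> E = {{a, b}, {b, c}})"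

definition is_triangle :: "'v::finite set set \<Rightarrow> bool" where
  "is_triangle E \<longleftrightarrow>
     (\<exists>a b c. distinct [a, b, c] \<and> UNIV = {a, b, c} \<and> E = {{a, b}, {b, c}, {c, a}})"


section \<open>Basic facts\<close>

lemma module_mult: "module ((*) :: 'a::comm_ring_1 \<Rightarrow> 'a \<Rightarrow> 'a)"
  by unfold_locales (auto simp: algebra_simps)

lemma lookup_mono_lcm [simp]:
  "Poly_Mapping.lookup (mono_lcm \<sigma>) v = Max (insert 0 ((\<lambda>m. Poly_Mapping.lookup m v) ` \<sigma>))"
  by (simp add: mono_lcm_def)

lemma mono_poly_add: "mono_poly (a + b) = mono_poly a * mono_poly b"
  by (simp add: mono_poly_def mult_single)

lemma mono_poly_in_ideal_of_iff:
  fixes A :: "'v monomial set"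
  shows "(mono_poly m :: ('v, 'k::field) mpoly) \<in> ideal_of (mono_poly ` A)
         \<longleftrightarrow> (\<exists>a\<in>A. \<exists>b. m = a + b)"
proof
  interpret module "(*) :: ('v, 'k) mpoly \<Rightarrow> _" by (rule module_mult)
  let ?P = "\<lambda>p :: ('v, 'k) mpoly. \<forall>k\<in>Poly_Mapping.keys p. \<exists>a\<in>A. \<exists>b. k = a + b"
  assume m: "(mono_poly m :: ('v, 'k) mpoly) \<in> ideal_of (mono_poly ` A)"
  have sub: "subspace {p. ?P p}"
  proof (rule subspaceI)
    fix x y assume "x \<in> {p. ?P p}" "y \<in> {p. ?P p}"
    then show "x + y \<in> {p. ?P p}"
      using Poly_Mapping.keys_add[of x y] by blast
  next
    fix c x assume x: "x \<in> {p. ?P p}"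
    have "\<exists>a\<in>A. \<exists>b. k = a + b" if k: "k \<in> Poly_Mapping.keys (c * x)" for k
    proof -
      obtain s t where st: "k = s + t" "t \<in> Poly_Mapping.keys x"
        using k keys_mult[of c x] by blast
      then obtain a b where "a \<in> A" "t = a + b" using x by blast
      then have "k = a + (s + b)" using st by (simp add: ac_simps)
      then show ?thesis using \<open>a \<in> A\<close> by blast
    qed
    then show "c * x \<in> {p. ?P p}" by blast
  qed simp
  have "mono_poly ` A \<subseteq> {p. ?P p}"
    by (auto simp: mono_poly_def) (metis add.right_neutral)
  then have "?P (mono_poly m)" using span_minimal[OF _ sub] m by blast
  then show "\<exists>a\<in>A. \<exists>b. m = a + b" by (simp add: mono_poly_def)
next
  interpret module "(*) :: ('v, 'k) mpoly \<Rightarrow> _" by (rule module_mult)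
  assume "\<exists>a\<in>A. \<exists>b. m = a + b"
  then obtain a b where "a \<in> A" "m = b + a" by (metis add.commute)
  then show "(mono_poly m :: ('v, 'k) mpoly) \<in> ideal_of (mono_poly ` A)"
    by (simp add: mono_poly_add span_scale span_base)
qed

lemma is_min_mono_gens_iff:
  fixes A :: "'v::finite monomial set" and I :: "('v, 'k::field) mpoly set"
  assumes I: "I = ideal_of (mono_poly ` A)"
  defines "M \<equiv> {m. mono_poly m \<in> I \<and> (\<forall>a b. m = a + b \<and> mono_poly a \<in> I \<longrightarrow> a = m)}"
  shows "is_min_mono_gens I B \<longleftrightarrow> B = M"
proof -
  interpret module "(*) :: ('v, 'k) mpoly \<Rightarrow> _" by (rule module_mult)
  have below: "\<exists>a\<in>M. \<exists>b. m = a + b" if "mono_poly m \<in> I" for m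
    using that
  proof (induction "sum (Poly_Mapping.lookup m) UNIV" arbitrary: m rule: less_induct)
    case less
    show ?case
    proof (cases "m \<in> M")
      case True
      then show ?thesis by (intro bexI[of _ m] exI[of _ 0]) simp_all
    next
      case False
      then obtain a b where ab: "m = a + b" "mono_poly a \<in> I" "a \<noteq> m"
        using less.prems by (auto simp: M_def)
      then have "b \<noteq> 0" by auto
      then obtain v where "Poly_Mapping.lookup b v \<noteq> 0" by (metis lookup_zero poly_mapping_eqI)
      then have "sum (Poly_Mapping.lookup b) UNIV > 0" by (simp add: sum_pos2[of _ v])
      then have "sum (Poly_Mapping.lookup a) UNIV < sum (Poly_Mapping.lookup m) UNIV"
        by (simp add: ab(1) lookup_add sum.distrib)
      from less.hyps[OF this ab(2)] obtain c d where "c \<in> M" "a = c + d" by blast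
      then have "c \<in> M" "m = c + (d + b)" by (simp_all add: ab(1) add.assoc)
      then show ?thesis by blast
    qed
  qed
  have lower: "M \<subseteq> B'" if B': "ideal_of (mono_poly ` B') = I" for B'
  proof
    fix m assume m: "m \<in> M"
    then have "mono_poly m \<in> I" by (simp add: M_def)
    then obtain a b where ab: "a \<in> B'" "m = a + b"
      using mono_poly_in_ideal_of_iff[of m B', where 'k = 'k] unfolding B' by blast
    have "mono_poly a \<in> I" using ab(1) B' span_base by blast
    moreover have "m = a + b \<and> mono_poly a \<in> I \<longrightarrow> a = m" using m unfolding M_def by blast
    ultimately have "a = m" using ab(2) by blast
    then show "m \<in> B'" using ab(1) by simp
  qed
  have gen: "ideal_of (mono_poly ` M) = I"
  proof
    have "mono_poly ` M \<subseteq> I" by (auto simp: M_def)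
    moreover have "subspace I" using I by simp
    ultimately show "ideal_of (mono_poly ` M) \<subseteq> I" by (rule span_minimal)
    have "(mono_poly a :: ('v, 'k) mpoly) \<in> ideal_of (mono_poly ` M)" if a: "a \<in> A" for a
    proof -
      have "mono_poly a \<in> I" unfolding I using a by (intro span_base imageI)
      from below[OF this] show ?thesis by (simp add: mono_poly_in_ideal_of_iff)
    qed
    then have "(mono_poly ` A :: ('v, 'k) mpoly set) \<subseteq> ideal_of (mono_poly ` M)" by blast
    then have "(ideal_of (mono_poly ` A) :: ('v, 'k) mpoly set) \<subseteq> ideal_of (mono_poly ` M)"
      by (rule span_minimal) (rule subspace_span)
    then show "I \<subseteq> ideal_of (mono_poly ` M)" using I by simp
  qed
  show ?thesis
  proof
    assume B: "is_min_mono_gens I B"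
    then have "M \<subseteq> B" by (simp add: is_min_mono_gens_def lower)
    moreover have "\<not> M \<subset> B" using B gen by (auto simp: is_min_mono_gens_def)
    ultimately show "B = M" by blast
  next
    assume "B = M"
    moreover have "ideal_of (mono_poly ` B') \<noteq> I" if B': "B' \<subset> M" for B'
      using lower[of B'] B' by blast
    ultimately show "is_min_mono_gens I B" using gen by (simp add: is_min_mono_gens_def)
  qed
qed

lemma Gens_monomial_ideal:
  fixes A :: "'v::finite monomial set" and I :: "('v, 'k::field) mpoly set"
  assumes "I = ideal_of (mono_poly ` A)"
  shows "is_min_mono_gens I (Gens I)"
    and "Gens I = {m. mono_poly m \<in> I \<and> (\<forall>a b. m = a + b \<and> mono_poly a \<in> I \<longrightarrow> a = m)}"
  unfolding Gens_def is_min_mono_gens_iff[OF assms] by simp_all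

end

theory Submission
  imports Defs
begin

text \<open>
  The generators of \<open>I(G)\<^sup>n\<close> are the sums of \<open>n\<close> edges (exponent vectors are added), all of
  degree \<open>2n\<close> (\<open>Gens_edge_ideal_power\<close>). The rest is combinatorics of this finite set \<open>M\<close>.

  Bridge-friendliness is restated first. A set \<open>\<sigma>\<close> is potentially-type-2 exactly if
  \<open>\<sigma> = T \<union> {p}\<close> where \<open>p\<close> divides the lcm of \<open>T\<close>, is the smallest bridge of \<open>\<sigma>\<close>, and no true
  gap of \<open>\<sigma>\<close> is smaller than \<open>p\<close>; then \<open>p\<close> is called critical for \<open>T\<close>. Two
  potentially-type-2 sets with the same \<open>T\<close> would each need a smallest bridge dominating the
  other one, so an order makes the ideal bridge-friendly if and only if every \<open>T\<close> has at most one
  critical element (\<open>all_type2_iff_critical_unique\<close>). Whether \<open>p\<close> is critical for \<open>T\<close> depends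
  only on generators dividing the lcm of \<open>T\<close>; hence the property passes to the set of generators
  dividing a fixed monomial (\<open>critical_unique_restrict\<close>), called a box below.

  For the negative direction it suffices to find in \<open>M\<close> a box that fails for every order. For a
  fixed box, "\<open>p\<close> is critical for \<open>T\<close>" is a conjunction of clauses in the atoms "\<open>a\<close> is smaller
  than \<open>b\<close>" (\<open>critical_iff_satisfied\<close>), and a short list of triples \<open>(T, p, q)\<close>, of which one
  would violate uniqueness under any order, excludes all orders at once. A connected graph with at
  least four vertices has four vertices that induce a connected graph: a path or a 4-cycle, a star,
  a triangle with a pendant edge (a paw), or a graph containing two triangles with a common edge (a
  diamond) (\<open>four_vertices_not_orderable\<close>). In each case the exponents outside a few small ones are
  forced by the degree and by the fact that the exponents over an independent set add up to at most
  \<open>n\<close>. So, up to multiplication by a power of a single edge, the box does not depend on \<open>n\<close>, except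
  that the star needs separate boxes for \<open>n = 2\<close> and \<open>n = 3\<close>. For the triangle the generators are
  all monomials of degree \<open>2n\<close> with exponents at most \<open>n\<close>, and the \<open>15\<close> generators of the fourth
  power reappear as a box of every higher power.

  For the positive direction, with an edge or a path of length two every variable has either the same
  exponent in all generators or different exponents in different generators, and then every order is
  good (\<open>critical_unique_if_injective_or_constant\<close>). For the triangle and \<open>n \<in> {2, 3}\<close> an order
  is given explicitly. Its smallest element \<open>c\<close> does most of the work: \<open>c\<close> is the only possible
  critical element of \<open>T\<close> unless all other elements of \<open>T\<close> have a smaller exponent than \<open>c\<close> at some
  common vertex (\<open>critical_least\<close>), and this leaves few sets \<open>T\<close>.
\<close>

section \<open>Bridge-friendliness as uniqueness of critical elements\<close>

abbreviation lookup :: "('a \<Rightarrow>\<^sub>0 'b::zero) \<Rightarrow> 'a \<Rightarrow> 'b" where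
  "lookup \<equiv> Poly_Mapping.lookup"

text \<open>
  Divisibility of \<open>m\<close> into the lcm of \<open>S\<close>. The two notions differ only for \<open>S = {}\<close> and \<open>m = 0\<close>,
  and \<open>0\<close> is not a generator of a proper ideal.
\<close>

definition cov :: "'v monomial set \<Rightarrow> 'v monomial \<Rightarrow> bool" where
  "cov S m \<longleftrightarrow> (\<forall>v. \<exists>s\<in>S. lookup m v \<le> lookup s v)"

lemma cov_mono: "cov S m \<Longrightarrow> S \<subseteq> T \<Longrightarrow> cov T m"
  unfolding cov_def by blast

lemma mono_lcm_eq_iff_cov:
  assumes fin: "finite S" and m: "m \<noteq> 0"
  shows "mono_lcm (S \<union> {m}) = mono_lcm (S - {m}) \<longleftrightarrow> cov (S - {m}) m"
proof -
  define L where "L v = lookup (mono_lcm (S - {m})) v" for v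
  have fin': "finite ((\<lambda>m. lookup m v) ` (S - {m}))" for v using fin by simp
  have L: "L v = Max (insert 0 ((\<lambda>m. lookup m v) ` (S - {m})))" for v
    unfolding L_def lookup_mono_lcm by (rule refl)
  have up: "lookup (mono_lcm (S \<union> {m})) v = max (lookup m v) (L v)" for v
  proof -
    have "insert 0 ((\<lambda>m. lookup m v) ` (S \<union> {m}))
        = insert (lookup m v) (insert 0 ((\<lambda>m. lookup m v) ` (S - {m})))" by auto
    then show ?thesis unfolding L lookup_mono_lcm
      using Max_insert[of "insert 0 ((\<lambda>m. lookup m v) ` (S - {m}))" "lookup m v"] fin'[of v] by simp
  qed
  have le: "lookup m v \<le> L v \<longleftrightarrow> lookup m v = 0 \<or> (\<exists>s\<in>S - {m}. lookup m v \<le> lookup s v)" for v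
    unfolding L using fin'[of v] by (subst Max_ge_iff) auto
  have "mono_lcm (S \<union> {m}) = mono_lcm (S - {m}) \<longleftrightarrow> (\<forall>v. max (lookup m v) (L v) = L v)"
  proof
    assume "mono_lcm (S \<union> {m}) = mono_lcm (S - {m})"
    then show "\<forall>v. max (lookup m v) (L v) = L v" using up L_def by (simp del: lookup_mono_lcm)
  next
    assume "\<forall>v. max (lookup m v) (L v) = L v"
    then have "lookup (mono_lcm (S \<union> {m})) v = lookup (mono_lcm (S - {m})) v" for v
      unfolding up L_def[symmetric] by (rule spec)
    then show "mono_lcm (S \<union> {m}) = mono_lcm (S - {m})" by (rule poly_mapping_eqI)
  qed
  also have "\<dots> \<longleftrightarrow> (\<forall>v. lookup m v \<le> L v)"
    by (simp add: max_def)
  also have "\<dots> \<longleftrightarrow> cov (S - {m}) m"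
  proof
    assume a: "\<forall>v. lookup m v \<le> L v"
    have "\<exists>w. lookup m w \<noteq> 0"
    proof (rule ccontr)
      assume "\<nexists>w. lookup m w \<noteq> 0"
      then have "m = 0" by (intro poly_mapping_eqI) simp
      then show False using m by blast
    qed
    then obtain w where w: "lookup m w \<noteq> 0" by blast
    then obtain t where t: "t \<in> S - {m}" using a le[of w] by auto
    show "cov (S - {m}) m"
      unfolding cov_def
    proof
      fix v show "\<exists>s\<in>S - {m}. lookup m v \<le> lookup s v"
        using a le[of v] t by (cases "lookup m v = 0") auto
    qed
  next
    assume "cov (S - {m}) m"
    then show "\<forall>v. lookup m v \<le> L v" using le unfolding cov_def by metis
  qed
  finally show ?thesis .
qed

text \<open>
  With \<open>(a, b) \<in> r\<close> for \<open>a \<succ> b\<close>: the fourth conjunct makes \<open>p\<close> the smallest bridge of \<open>T \<union> {p}\<close>,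
  and the last one says that a gap \<open>g\<close> below \<open>p\<close> is never a true gap, because adding \<open>g\<close> turns some
  \<open>b\<close> below \<open>g\<close> into a bridge. The relation \<open>C\<close> is a parameter so that the notion can be moved from
  monomials to index sets.
\<close>

definition critical :: "('a set \<Rightarrow> 'a \<Rightarrow> bool) \<Rightarrow> 'a set \<Rightarrow> ('a \<times> 'a) set \<Rightarrow> 'a set \<Rightarrow> 'a \<Rightarrow> bool" where
  "critical C M r T p \<longleftrightarrow>
     T \<subseteq> M \<and> p \<in> M - T \<and> C T p \<and>
     (\<forall>b\<in>T. C (insert p T - {b}) b \<longrightarrow> (b, p) \<in> r) \<and>
     (\<forall>g\<in>M - insert p T. C (insert p T) g \<and> (p, g) \<in> r \<longrightarrow>
        (\<exists>b\<in>T. C (insert g (insert p T) - {b}) b \<and> \<not> C (insert p T - {b}) b \<and> (g, b) \<in> r))"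

definition critical_unique :: "('a set \<Rightarrow> 'a \<Rightarrow> bool) \<Rightarrow> 'a set \<Rightarrow> ('a \<times> 'a) set \<Rightarrow> bool" where
  "critical_unique C M r \<longleftrightarrow> (\<forall>T p q. critical C M r T p \<and> critical C M r T q \<longrightarrow> p = q)"

text \<open>
  If the least element \<open>c\<close> divides the lcm of the rest of \<open>T\<close>, it is a bridge or a gap of
  \<open>T \<union> {p}\<close>. As a bridge it would be smaller than \<open>p\<close>; as a gap it would be a true one, since nothing
  lies below it.
\<close>

lemma critical_least:
  assumes mono: "\<And>S S' m. C S m \<Longrightarrow> S \<subseteq> S' \<Longrightarrow> C S' m"
    and c: "c \<in> M" and least: "\<And>m. m \<in> M \<Longrightarrow> m \<noteq> c \<Longrightarrow> (m, c) \<in> r"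
    and nc: "\<And>m. m \<in> M \<Longrightarrow> (c, m) \<notin> r"
    and crit: "critical C M r T p" and cc: "C (T - {c}) c"
  shows "p = c"
proof (rule ccontr)
  assume ne: "p \<noteq> c"
  then have pc: "(p, c) \<in> r" using least crit unfolding critical_def by blast
  show False
  proof (cases "c \<in> T")
    case True
    moreover have "C (insert p T - {c}) c" by (rule mono[OF cc]) blast
    ultimately have "(c, p) \<in> r" using crit unfolding critical_def by blast
    then show False using nc crit unfolding critical_def by blast
  next
    case False
    then have "c \<in> M - insert p T" using c ne by blast
    moreover have "C (insert p T) c" by (rule mono[OF cc]) blast
    ultimately obtain b where "b \<in> T" "(c, b) \<in> r" using crit pc unfolding critical_def by blast
    then show False using nc crit unfolding critical_def by blast
  qed
qed

lemma strict_linear_order_on_transD: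
  "strict_linear_order_on M r \<Longrightarrow> (a, b) \<in> r \<Longrightarrow> (b, c) \<in> r \<Longrightarrow> (a, c) \<in> r"
  unfolding strict_linear_order_on_def trans_def by blast

lemma strict_linear_order_on_irreflD: "strict_linear_order_on M r \<Longrightarrow> (a, a) \<notin> r"
  unfolding strict_linear_order_on_def irrefl_def by blast

lemma strict_linear_order_on_totalD:
  "strict_linear_order_on M r \<Longrightarrow> a \<in> M \<Longrightarrow> b \<in> M \<Longrightarrow> a \<noteq> b \<Longrightarrow> (a, b) \<in> r \<or> (b, a) \<in> r"
  unfolding strict_linear_order_on_def total_on_def by blast

context
  fixes M :: "'v::finite monomial set" and r :: "'v monomial rel"
  assumes finM: "finite M" and M0: "0 \<notin> M" and r: "strict_linear_order_on M r"
begin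

lemmas trans_r = strict_linear_order_on_transD[OF r]
lemmas irrefl_r = strict_linear_order_on_irreflD[OF r]
lemmas total_r = strict_linear_order_on_totalD[OF r]

lemma is_bridge_iff: "S \<subseteq> M \<Longrightarrow> is_bridge M S m \<longleftrightarrow> m \<in> S \<and> cov (S - {m}) m"
  using mono_lcm_eq_iff_cov[of S m] finite_subset[OF _ finM, of S] M0
  unfolding is_bridge_def by auto

lemma is_gap_iff: "S \<subseteq> M \<Longrightarrow> is_gap M S m \<longleftrightarrow> m \<in> M - S \<and> cov S m"
  using mono_lcm_eq_iff_cov[of S m] finite_subset[OF _ finM, of S] M0
  unfolding is_gap_def by (cases "m = 0") auto

lemma is_true_gap_iff:
  assumes S: "S \<subseteq> M"
  shows "is_true_gap M r S g \<longleftrightarrow> g \<in> M - S \<and> cov S g \<and>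
     (\<forall>b\<in>S. cov (insert g S - {b}) b \<and> (g, b) \<in> r \<longrightarrow> cov (S - {b}) b)"
proof (cases "g \<in> M - S \<and> cov S g")
  case True
  then have U: "S \<union> {g} \<subseteq> M" "insert g S \<subseteq> M" and gap: "is_gap M S g"
    using S is_gap_iff[OF S] by auto
  have "is_true_gap M r S g \<longleftrightarrow>
      (\<forall>b. (b \<in> insert g S \<and> cov (insert g S - {b}) b) \<and> (g, b) \<in> r \<longrightarrow> b \<in> S \<and> cov (S - {b}) b)"
    using gap unfolding is_true_gap_def is_bridge_iff[OF U(1)] is_bridge_iff[OF S] by simp
  also have "\<dots> \<longleftrightarrow> (\<forall>b\<in>S. cov (insert g S - {b}) b \<and> (g, b) \<in> r \<longrightarrow> cov (S - {b}) b)"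
    using irrefl_r by blast
  finally show ?thesis using True by simp
next
  case False
  then have "\<not> is_gap M S g" using is_gap_iff[OF S] by simp
  then show ?thesis using False unfolding is_true_gap_def by blast
qed

lemma linear_min:
  assumes "B \<subseteq> M" "B \<noteq> {}"
  obtains p where "p \<in> B" "\<And>b. b \<in> B \<Longrightarrow> b \<noteq> p \<Longrightarrow> (b, p) \<in> r"
proof -
  have "finite B" using assms(1) finM by (rule finite_subset)
  then have "\<exists>p\<in>B. \<forall>b\<in>B. b \<noteq> p \<longrightarrow> (b, p) \<in> r"
    using assms(2,1)
  proof (induction rule: finite_ne_induct)
    case (singleton x)
    then show ?case by simp
  next
    case (insert x F)
    then obtain p where p: "p \<in> F" "\<forall>b\<in>F. b \<noteq> p \<longrightarrow> (b, p) \<in> r" by blast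
    have "x \<in> M" "p \<in> M" "x \<noteq> p" using insert p(1) by auto
    then have "(x, p) \<in> r \<or> (p, x) \<in> r" by (rule total_r)
    then show ?case
    proof
      assume "(x, p) \<in> r"
      then show ?thesis using p by (intro bexI[of _ p]) auto
    next
      assume px: "(p, x) \<in> r"
      then have "(b, x) \<in> r" if "b \<in> F" for b using p(2) that trans_r[of b p x] by (cases "b = p") auto
      then show ?thesis by (intro bexI[of _ x]) auto
    qed
  qed
  then show ?thesis using that by auto
qed

lemma smallest_bridge_eqI:
  assumes "is_bridge M S p" "\<And>b. is_bridge M S b \<Longrightarrow> b \<noteq> p \<Longrightarrow> (b, p) \<in> r"
  shows "smallest_bridge M r S = Some p"
proof -
  have "(THE m. is_bridge M S m \<and> (\<forall>m'. is_bridge M S m' \<and> m' \<noteq> m \<longrightarrow> (m', m) \<in> r)) = p"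
  proof (rule the_equality)
    show "is_bridge M S p \<and> (\<forall>m'. is_bridge M S m' \<and> m' \<noteq> p \<longrightarrow> (m', p) \<in> r)"
      using assms by blast
  next
    fix m assume m: "is_bridge M S m \<and> (\<forall>m'. is_bridge M S m' \<and> m' \<noteq> m \<longrightarrow> (m', m) \<in> r)"
    show "m = p"
    proof (rule ccontr)
      assume "m \<noteq> p"
      then have "(p, m) \<in> r" "(m, p) \<in> r" using m assms by auto
      then show False using trans_r[of m p m] irrefl_r[of m] by simp
    qed
  qed
  then show ?thesis using assms(1) unfolding smallest_bridge_def by auto
qed

text \<open>
  The next two lemmas identify the potentially-type-2 sets with the pairs of a set \<open>T\<close> and an element
  critical for it. If some bridge dominates no true gap, then by transitivity neither does the
  smallest bridge.
\<close>

lemma critical_imp_potentially_type2: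
  assumes c: "critical cov M r T p"
  shows "potentially_type2 M r (insert p T)" and "smallest_bridge M r (insert p T) = Some p"
proof -
  let ?S = "insert p T"
  have S: "?S \<subseteq> M" and pT: "p \<notin> T" using c unfolding critical_def by auto
  then have d: "?S - {p} = T" by blast
  have bp: "is_bridge M ?S p" using c is_bridge_iff[OF S] d unfolding critical_def by simp
  have "\<not> is_true_gap M r ?S g" if "(p, g) \<in> r" for g
    using c that unfolding is_true_gap_iff[OF S] critical_def by blast
  then show "potentially_type2 M r ?S" using S bp unfolding potentially_type2_def by blast
  show "smallest_bridge M r ?S = Some p"
    using c is_bridge_iff[OF S] by (intro smallest_bridge_eqI bp) (auto simp: critical_def)
qed

lemma potentially_type2_imp_critical:
  assumes p2: "potentially_type2 M r S"
  obtains p where "p \<in> S" "smallest_bridge M r S = Some p" "critical cov M r (S - {p}) p"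
proof -
  from p2 obtain m where S: "S \<subseteq> M" and m: "is_bridge M S m"
    and ng: "\<And>g. is_true_gap M r S g \<Longrightarrow> (m, g) \<notin> r"
    unfolding potentially_type2_def by blast
  obtain p where p: "is_bridge M S p" and pmin: "\<And>b. is_bridge M S b \<Longrightarrow> b \<noteq> p \<Longrightarrow> (b, p) \<in> r"
  proof (rule linear_min[of "{b. is_bridge M S b}"])
    show "{b. is_bridge M S b} \<subseteq> M" by (auto simp: is_bridge_def)
    show "{b. is_bridge M S b} \<noteq> {}" using m by blast
  qed (use that in auto)
  have ngp: "\<not> is_true_gap M r S g" if "(p, g) \<in> r" for g
    using that ng[of g] trans_r[of m p g] pmin[OF m] by (cases "m = p") auto
  have pS: "p \<in> S" "cov (S - {p}) p" using p is_bridge_iff[OF S] by auto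
  then have d: "insert p (S - {p}) = S" by blast
  have bpr: "\<And>b. b \<in> S \<Longrightarrow> b \<noteq> p \<Longrightarrow> cov (S - {b}) b \<Longrightarrow> (b, p) \<in> r"
    using pmin is_bridge_iff[OF S] by blast
  have gap: "\<exists>b\<in>S - {p}. cov (insert g S - {b}) b \<and> \<not> cov (S - {b}) b \<and> (g, b) \<in> r"
    if "g \<in> M - S" "cov S g" "(p, g) \<in> r" for g
    using that ngp[of g] pS unfolding is_true_gap_iff[OF S] by blast
  have "critical cov M r (S - {p}) p"
    unfolding critical_def d using S pS bpr gap by blast
  then show ?thesis using that pS(1) smallest_bridge_eqI[OF p pmin] by blast
qed

text \<open>
  The condition for type 2 is asymmetric in the two sets, so it cannot hold for both members of a
  conflicting pair; when all potentially-type-2 sets are type-2, there is no such pair at all.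
\<close>

lemma all_type2_iff_critical_unique:
  "(\<forall>S\<subseteq>M. potentially_type2 M r S \<longrightarrow> type2 M r S) \<longleftrightarrow> critical_unique cov M r"
proof
  assume t2: "\<forall>S\<subseteq>M. potentially_type2 M r S \<longrightarrow> type2 M r S"
  show "critical_unique cov M r"
    unfolding critical_unique_def
  proof (intro allI impI, elim conjE)
    fix T p q assume p: "critical cov M r T p" and q: "critical cov M r T q"
    note P = critical_imp_potentially_type2[OF p] and Q = critical_imp_potentially_type2[OF q]
    have sub: "insert p T \<subseteq> M" "insert q T \<subseteq> M" "p \<notin> T" "q \<notin> T"
      using p q unfolding critical_def by auto
    show "p = q"
    proof (rule ccontr)
      assume "p \<noteq> q"
      then have ne: "insert p T \<noteq> insert q T" using sub by blast
      have "type2 M r (insert p T)" "type2 M r (insert q T)" using t2 sub P Q by blast+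
      then have "(q, p) \<in> r" "(p, q) \<in> r"
        using ne P Q sub unfolding type2_def by (auto simp: insert_Diff_if)
      then show False using trans_r[of p q p] irrefl_r[of p] by simp
    qed
  qed
next
  assume u: "critical_unique cov M r"
  show "\<forall>S\<subseteq>M. potentially_type2 M r S \<longrightarrow> type2 M r S"
  proof (intro allI impI)
    fix S assume "S \<subseteq> M" and S: "potentially_type2 M r S"
    have False if S': "potentially_type2 M r S'" and ne: "S' \<noteq> S"
      and eq: "S' - set_option (smallest_bridge M r S') = S - set_option (smallest_bridge M r S)" for S'
    proof -
      obtain p where p: "p \<in> S" "smallest_bridge M r S = Some p" "critical cov M r (S - {p}) p"
        using potentially_type2_imp_critical[OF S] .
      obtain q where q: "q \<in> S'" "smallest_bridge M r S' = Some q" "critical cov M r (S' - {q}) q"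
        using potentially_type2_imp_critical[OF S'] .
      have e: "S' - {q} = S - {p}" using eq p q by simp
      then have "q = p" using u p(3) q(3) unfolding critical_unique_def by metis
      then show False using e p q ne by blast
    qed
    then show "type2 M r S" using S unfolding type2_def by blast
  qed
qed

text \<open>
  If \<open>p \<succ> q\<close> are both critical for \<open>T\<close>, then adding the gap \<open>q\<close> to \<open>T \<union> {p}\<close> creates a bridge \<open>b\<close>,
  so at some vertex \<open>b\<close> had the strictly largest exponent before and \<open>q\<close> reaches it. But \<open>q\<close> divides
  the lcm of \<open>T\<close>, so \<open>q\<close> and \<open>b\<close> have the same exponent there, and the exponents at that vertex are
  not constant. Thus \<open>q = b\<close>.
\<close>

lemma critical_unique_if_injective_or_constant:
  assumes H: "\<And>v. (\<forall>m\<in>M. \<forall>m'\<in>M. lookup m v = lookup m' v) \<or> inj_on (\<lambda>m. lookup m v) M"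
  shows "critical_unique cov M r"
proof -
  have *: False if p: "critical cov M r T p" and q: "critical cov M r T q" and pq: "(p, q) \<in> r" for T p q
  proof -
    have T: "T \<subseteq> M" "p \<in> M - T" "q \<in> M - T" "cov T q" "p \<noteq> q"
      using p q pq irrefl_r unfolding critical_def by auto
    then have "q \<in> M - insert p T" "cov (insert p T) q" by (auto intro: cov_mono)
    then obtain b where b: "b \<in> T" "cov (insert q (insert p T) - {b}) b" "\<not> cov (insert p T - {b}) b"
      using p pq unfolding critical_def by blast
    from b(3) obtain v where v: "\<And>s. s \<in> insert p T - {b} \<Longrightarrow> \<not> lookup b v \<le> lookup s v"
      unfolding cov_def by blast
    have bM: "b \<in> M" using b T by blast
    have "p \<in> insert p T - {b}" using b T by blast
    then have "lookup b v \<noteq> lookup p v" using v by fastforce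
    then have inj: "inj_on (\<lambda>m. lookup m v) M" using H[of v] bM T by blast
    obtain s where "s \<in> insert q (insert p T) - {b}" "lookup b v \<le> lookup s v"
      using b(2) unfolding cov_def by blast
    then have bq: "lookup b v \<le> lookup q v" using v by blast
    obtain t where t: "t \<in> T" "lookup q v \<le> lookup t v" using T(4) unfolding cov_def by blast
    then have "t = b" using v bq by (meson DiffI empty_iff insertCI insertE order_trans)
    then have "lookup q v = lookup b v" using bq t by simp
    then have "q = b" using inj T bM by (auto dest: inj_onD)
    then show False using b T by blast
  qed
  show ?thesis
    unfolding critical_unique_def
  proof (intro allI impI, elim conjE)
    fix T p q assume pq: "critical cov M r T p" "critical cov M r T q"
    then have "p \<in> M" "q \<in> M" unfolding critical_def by auto
    then show "p = q" using * pq total_r by blast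
  qed
qed

end

section \<open>Restriction to the divisors of a monomial\<close>

text \<open>
  Every gap of \<open>T \<union> {p}\<close> divides the lcm of \<open>T \<union> {p}\<close>, hence every common multiple \<open>u\<close> of its
  elements. So the test for criticality never leaves the divisors of \<open>u\<close>, which may be renamed along
  the bijection \<open>e\<close>.
\<close>

lemma critical_transfer:
  assumes inj: "inj_on e X" and down: "e ` X = {m \<in> M. \<forall>v. lookup m v \<le> u v}"
    and C: "\<And>S x. S \<subseteq> X \<Longrightarrow> x \<in> X \<Longrightarrow> C S x \<longleftrightarrow> cov (e ` S) (e x)"
    and r': "\<And>x y. x \<in> X \<Longrightarrow> y \<in> X \<Longrightarrow> (x, y) \<in> r' \<longleftrightarrow> (e x, e y) \<in> r"
    and T: "T \<subseteq> X" and p: "p \<in> X"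
  shows "critical C X r' T p \<longleftrightarrow> critical cov M r (e ` T) (e p)"
proof -
  have eX: "e x \<in> M" "lookup (e x) v \<le> u v" if "x \<in> X" for x v
    using imageI[OF that, of e] unfolding down by auto
  have eM: "e ` S \<subseteq> M" if "S \<subseteq> X" for S using that eX(1) by auto
  have ins: "insert (e x) (e ` S) = e ` insert x S" for x S by simp
  have del: "e ` S - {e b} = e ` (S - {b})" if "S \<subseteq> X" "b \<in> X" for S b
    using inj_on_image_set_diff[OF inj, of S "{b}"] that by auto
  have mem: "e x \<in> e ` S \<longleftrightarrow> x \<in> S" if "S \<subseteq> X" "x \<in> X" for S x
    using inj_on_image_mem_iff[OF inj that(2) that(1)] .
  have pT: "insert p T \<subseteq> X" using T p by blast
  have below: "g \<in> e ` X" if gM: "g \<in> M" and gc: "cov (e ` S) g" and SX: "S \<subseteq> X" for g S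
  proof -
    have "lookup g v \<le> u v" for v
    proof -
      obtain s where "s \<in> S" "lookup g v \<le> lookup (e s) v" using gc unfolding cov_def by blast
      then show ?thesis using eX(2)[of s v] SX by fastforce
    qed
    then show ?thesis unfolding down using gM by simp
  qed
  have b1: "(\<forall>b\<in>e ` T. cov (insert (e p) (e ` T) - {b}) b \<longrightarrow> (b, e p) \<in> r)
      \<longleftrightarrow> (\<forall>b\<in>T. C (insert p T - {b}) b \<longrightarrow> (b, p) \<in> r')"
  proof -
    have "cov (insert (e p) (e ` T) - {e b}) (e b) = C (insert p T - {b}) b" if "b \<in> T" for b
      unfolding ins using that T pT by (subst del) (auto intro!: C[symmetric])
    moreover have "(e b, e p) \<in> r \<longleftrightarrow> (b, p) \<in> r'" if "b \<in> T" for b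
      using that T p by (auto simp: r')
    ultimately show ?thesis by simp
  qed
  have b2: "(\<forall>g\<in>M - insert (e p) (e ` T). cov (insert (e p) (e ` T)) g \<and> (e p, g) \<in> r \<longrightarrow>
        (\<exists>b\<in>e ` T. cov (insert g (insert (e p) (e ` T)) - {b}) b \<and>
           \<not> cov (insert (e p) (e ` T) - {b}) b \<and> (g, b) \<in> r))
      \<longleftrightarrow> (\<forall>g\<in>X - insert p T. C (insert p T) g \<and> (p, g) \<in> r' \<longrightarrow>
        (\<exists>b\<in>T. C (insert g (insert p T) - {b}) b \<and> \<not> C (insert p T - {b}) b \<and> (g, b) \<in> r'))"
    (is "?A \<longleftrightarrow> ?B")
  proof -
    have eqv: "(e g \<in> M - insert (e p) (e ` T) \<and> cov (insert (e p) (e ` T)) (e g) \<and> (e p, e g) \<in> r \<longrightarrow>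
        (\<exists>b\<in>e ` T. cov (insert (e g) (insert (e p) (e ` T)) - {b}) b \<and>
           \<not> cov (insert (e p) (e ` T) - {b}) b \<and> (e g, b) \<in> r))
      \<longleftrightarrow> (g \<in> X - insert p T \<and> C (insert p T) g \<and> (p, g) \<in> r' \<longrightarrow>
        (\<exists>b\<in>T. C (insert g (insert p T) - {b}) b \<and> \<not> C (insert p T - {b}) b \<and> (g, b) \<in> r'))"
      if g: "g \<in> X" for g
    proof -
      have gT: "insert g (insert p T) \<subseteq> X" using g pT by blast
      have "e g \<in> M - insert (e p) (e ` T) \<longleftrightarrow> g \<in> X - insert p T"
        unfolding ins using mem[OF pT g] g eM[of X] by auto
      moreover have "cov (insert (e p) (e ` T)) (e g) = C (insert p T) g"
        unfolding ins using C[OF pT g] by simp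
      moreover have "(e p, e g) \<in> r \<longleftrightarrow> (p, g) \<in> r'" using r'[OF p g] by simp
      moreover have "cov (insert (e g) (insert (e p) (e ` T)) - {e b}) (e b)
          = C (insert g (insert p T) - {b}) b" if "b \<in> T" for b
        unfolding ins using that T gT by (subst del) (auto intro!: C[symmetric])
      moreover have "cov (insert (e p) (e ` T) - {e b}) (e b) = C (insert p T - {b}) b" if "b \<in> T" for b
        unfolding ins using that T pT by (subst del) (auto intro!: C[symmetric])
      moreover have "(e g, e b) \<in> r \<longleftrightarrow> (g, b) \<in> r'" if "b \<in> T" for b
        using that T g by (auto simp: r')
      ultimately show ?thesis by simp
    qed
    have "?A \<longleftrightarrow> (\<forall>g\<in>X. e g \<in> M - insert (e p) (e ` T) \<and> cov (insert (e p) (e ` T)) (e g) \<and> (e p, e g) \<in> r \<longrightarrow>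
        (\<exists>b\<in>e ` T. cov (insert (e g) (insert (e p) (e ` T)) - {b}) b \<and>
           \<not> cov (insert (e p) (e ` T) - {b}) b \<and> (e g, b) \<in> r))"
      (is "_ \<longleftrightarrow> (\<forall>g\<in>X. ?Q (e g))")
    proof
      assume A: ?A
      show "\<forall>g\<in>X. ?Q (e g)"
      proof (intro ballI impI, elim conjE)
        fix g assume "e g \<in> M - insert (e p) (e ` T)" "cov (insert (e p) (e ` T)) (e g)" "(e p, e g) \<in> r"
        then show "\<exists>b\<in>e ` T. cov (insert (e g) (insert (e p) (e ` T)) - {b}) b \<and>
           \<not> cov (insert (e p) (e ` T) - {b}) b \<and> (e g, b) \<in> r" using A by simp
      qed
    next
      assume Q: "\<forall>g\<in>X. ?Q (e g)"
      show ?A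
      proof (intro ballI impI, elim conjE)
        fix g assume g: "g \<in> M - insert (e p) (e ` T)" "cov (insert (e p) (e ` T)) g" "(e p, g) \<in> r"
        then obtain x where x: "x \<in> X" "g = e x" using below[OF _ _ pT] unfolding ins by blast
        have "?Q (e x)" using Q x(1) by blast
        then show "\<exists>b\<in>e ` T. cov (insert g (insert (e p) (e ` T)) - {b}) b \<and>
           \<not> cov (insert (e p) (e ` T) - {b}) b \<and> (g, b) \<in> r" using g unfolding x(2) by simp
      qed
    qed
    also have "\<dots> \<longleftrightarrow> (\<forall>g\<in>X. g \<in> X - insert p T \<and> C (insert p T) g \<and> (p, g) \<in> r' \<longrightarrow>
        (\<exists>b\<in>T. C (insert g (insert p T) - {b}) b \<and> \<not> C (insert p T - {b}) b \<and> (g, b) \<in> r'))"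
      using eqv by (rule ball_cong[OF refl])
    also have "\<dots> \<longleftrightarrow> ?B" by blast
    finally show ?thesis .
  qed
  show ?thesis
    unfolding critical_def b1 b2
    using T p eM[OF T] eM[of X] mem[OF T p] C[OF T p] by auto
qed

lemma critical_unique_restrict:
  assumes inj: "inj_on e X" and down: "e ` X = {m \<in> M. \<forall>v. lookup m v \<le> u v}"
    and C: "\<And>S x. S \<subseteq> X \<Longrightarrow> x \<in> X \<Longrightarrow> C S x \<longleftrightarrow> cov (e ` S) (e x)"
    and r': "\<And>x y. x \<in> X \<Longrightarrow> y \<in> X \<Longrightarrow> (x, y) \<in> r' \<longleftrightarrow> (e x, e y) \<in> r"
    and un: "critical_unique cov M r"
  shows "critical_unique C X r'"
  unfolding critical_unique_def
proof (intro allI impI, elim conjE)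
  fix T p q assume p: "critical C X r' T p" and q: "critical C X r' T q"
  then have X: "T \<subseteq> X" "p \<in> X" "q \<in> X" unfolding critical_def by auto
  then have "e p = e q"
    using p q un critical_transfer[OF inj down C r', of T] unfolding critical_unique_def by metis
  then show "p = q" using inj X by (auto dest: inj_onD)
qed

text \<open>
  The case in which all of \<open>M\<close> lies below the bound, where uniqueness also transfers back to \<open>M\<close>.
\<close>

lemma critical_unique_extend:
  assumes inj: "inj_on e X" and M: "e ` X = M"
    and C: "\<And>S x. S \<subseteq> X \<Longrightarrow> x \<in> X \<Longrightarrow> C S x \<longleftrightarrow> cov (e ` S) (e x)"
    and r': "\<And>x y. x \<in> X \<Longrightarrow> y \<in> X \<Longrightarrow> (x, y) \<in> r' \<longleftrightarrow> (e x, e y) \<in> r"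
    and bnd: "\<And>m v. m \<in> M \<Longrightarrow> lookup m v \<le> u"
    and un: "critical_unique C X r'"
  shows "critical_unique cov M r"
  unfolding critical_unique_def
proof (intro allI impI, elim conjE)
  fix T p q assume p: "critical cov M r T p" and q: "critical cov M r T q"
  have down: "e ` X = {m \<in> M. \<forall>v. lookup m v \<le> u}" using M bnd by blast
  from p q have "T \<subseteq> e ` X" "p \<in> e ` X" "q \<in> e ` X" unfolding critical_def M by auto
  then obtain T' p' q' where X: "T' \<subseteq> X" "T = e ` T'" "p' \<in> X" "p = e p'" "q' \<in> X" "q = e q'"
    by (metis imageE subset_image_iff)
  have "critical C X r' T' p'" "critical C X r' T' q'"
    using p q critical_transfer[OF inj down C r' X(1)] X by auto
  then have "p' = q'" using un unfolding critical_unique_def by blast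
  then show "p = q" using X by simp
qed

section \<open>Lists of exponent vectors\<close>

text \<open>
  From here on a set of generators is a list \<open>L\<close> of exponent vectors, its elements are the positions
  \<open>0, \<dots>, length L - 1\<close>, and an order is a rank function on the positions. Everything that does not
  involve the order can then be computed.
\<close>

definition covers :: "nat list list \<Rightarrow> nat set \<Rightarrow> nat \<Rightarrow> bool" where
  "covers L S i \<longleftrightarrow> (\<forall>k<length (L ! i). \<exists>s\<in>S. L ! i ! k \<le> L ! s ! k)"

definition covers_list :: "nat list list \<Rightarrow> nat list \<Rightarrow> nat \<Rightarrow> bool" where
  "covers_list L xs i \<longleftrightarrow> list_all (\<lambda>k. list_ex (\<lambda>s. L ! i ! k \<le> L ! s ! k) xs) [0..<length (L ! i)]"

definition admissible :: "nat list list \<Rightarrow> nat list \<Rightarrow> nat \<Rightarrow> bool" where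
  "admissible L T p \<longleftrightarrow>
     list_all (\<lambda>t. t < length L) T \<and> p < length L \<and> \<not> List.member T p \<and> covers_list L T p"

text \<open>
  A conjunction of clauses, each a disjunction of atoms \<open>(a, b)\<close> that stand for "\<open>a\<close> is smaller than
  \<open>b\<close>". The unit clauses make \<open>p\<close> smaller than every other bridge \<open>b\<close> of \<open>T \<union> {p}\<close>. The clause of a
  gap \<open>g\<close> says that \<open>p\<close> is smaller than \<open>g\<close> or that some \<open>b\<close> smaller than \<open>g\<close> becomes a bridge when
  \<open>g\<close> is added.
\<close>

definition clauses :: "nat list list \<Rightarrow> nat list \<Rightarrow> nat \<Rightarrow> (nat \<times> nat) list list" where
  "clauses L T p =
     map (\<lambda>b. [(p, b)]) (filter (\<lambda>b. covers_list L (p # removeAll b T) b) T) @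
     map (\<lambda>g. (p, g) # map (\<lambda>b. (b, g))
            (filter (\<lambda>b. covers_list L (g # p # removeAll b T) b \<and> \<not> covers_list L (p # removeAll b T) b) T))
       (filter (\<lambda>g. g \<noteq> p \<and> \<not> List.member T g \<and> covers_list L (p # T) g) [0..<length L])"

definition satisfied :: "(nat \<Rightarrow> nat) \<Rightarrow> (nat \<times> nat) list list \<Rightarrow> bool" where
  "satisfied f cs \<longleftrightarrow> list_all (list_ex (\<lambda>(a, b). f a < f b)) cs"

definition rank_order :: "(nat \<Rightarrow> nat) \<Rightarrow> (nat \<times> nat) set" where
  "rank_order f = {(x, y). f y < f x}"

lemma covers_list: "covers_list L xs i \<longleftrightarrow> covers L (set xs) i"
  unfolding covers_list_def covers_def by (auto simp: list_all_iff list_ex_iff)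

lemma covers_mono: "covers L S m \<Longrightarrow> S \<subseteq> S' \<Longrightarrow> covers L S' m"
  unfolding covers_def by blast

lemma critical_iff_satisfied:
  assumes f: "inj_on f {..<length L}"
  shows "critical (covers L) {..<length L} (rank_order f) (set T) p
    \<longleftrightarrow> admissible L T p \<and> satisfied f (clauses L T p)"
proof (cases "admissible L T p")
  case False
  then show ?thesis
    unfolding critical_def admissible_def covers_list list_all_iff List.member_iff by auto
next
  case True
  then have T: "set T \<subseteq> {..<length L}" and p: "p < length L" "p \<notin> set T" and c: "covers L (set T) p"
    unfolding admissible_def covers_list list_all_iff List.member_iff by auto
  have d1: "set (p # removeAll b T) = insert p (set T) - {b}" if "b \<in> set T" for b
    using that p by auto
  have d2: "set (g # p # removeAll b T) = insert g (insert p (set T)) - {b}"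
    if "b \<in> set T" "g \<notin> set T" for b g
    using that p by auto
  have gp: "f g < f p \<longleftrightarrow> \<not> f p < f g" if "g < length L" "g \<noteq> p" for g
    using inj_onD[OF f, of g p] that p by (auto simp: not_less order_le_less)
  have A: "(\<forall>b\<in>set T. covers L (insert p (set T) - {b}) b \<longrightarrow> f p < f b) \<longleftrightarrow>
      list_all (list_ex (\<lambda>(a, b). f a < f b))
        (map (\<lambda>b. [(p, b)]) (filter (\<lambda>b. covers_list L (p # removeAll b T) b) T))"
    unfolding list_all_iff covers_list using d1 by auto
  have B: "(\<forall>g\<in>{..<length L} - insert p (set T). covers L (insert p (set T)) g \<and> f g < f p \<longrightarrow>
        (\<exists>b\<in>set T. covers L (insert g (insert p (set T)) - {b}) b \<and>
           \<not> covers L (insert p (set T) - {b}) b \<and> f b < f g)) \<longleftrightarrow>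
      list_all (list_ex (\<lambda>(a, b). f a < f b))
       (map (\<lambda>g. (p, g) # map (\<lambda>b. (b, g))
            (filter (\<lambda>b. covers_list L (g # p # removeAll b T) b \<and> \<not> covers_list L (p # removeAll b T) b) T))
       (filter (\<lambda>g. g \<noteq> p \<and> \<not> List.member T g \<and> covers_list L (p # T) g) [0..<length L]))"
    (is "?l \<longleftrightarrow> ?r")
  proof -
    have "?r \<longleftrightarrow> (\<forall>g. g < length L \<and> g \<noteq> p \<and> g \<notin> set T \<and> covers L (insert p (set T)) g \<longrightarrow>
        f p < f g \<or> (\<exists>b\<in>set T. covers L (set (g # p # removeAll b T)) b \<and>
           \<not> covers L (set (p # removeAll b T)) b \<and> f b < f g))"
      unfolding list_all_iff list_ex_iff covers_list List.member_iff by auto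
    also have "\<dots> \<longleftrightarrow> (\<forall>g. g < length L \<and> g \<noteq> p \<and> g \<notin> set T \<and> covers L (insert p (set T)) g \<longrightarrow>
        f p < f g \<or> (\<exists>b\<in>set T. covers L (insert g (insert p (set T)) - {b}) b \<and>
           \<not> covers L (insert p (set T) - {b}) b \<and> f b < f g))"
      using d1 d2 by metis
    also have "\<dots> \<longleftrightarrow> ?l" using gp by auto
    finally show ?thesis by simp
  qed
  show ?thesis
    unfolding critical_def satisfied_def clauses_def list_all_append rank_order_def mem_Collect_eq case_prod_conv
      A B using T p c True by auto
qed

definition unorderable :: "nat list list \<Rightarrow> bool" where
  "unorderable L \<longleftrightarrow>
     (\<forall>f. inj_on f {..<length L} \<longrightarrow> \<not> critical_unique (covers L) {..<length L} (rank_order f))"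

text \<open>
  The negation of \<open>satisfied\<close> for an injective rank, with strict inequalities only. Ranks are integers
  here since only the order matters and linear arithmetic over the integers decides the resulting
  formulas.
\<close>

definition violated :: "(nat \<Rightarrow> int) \<Rightarrow> (nat \<times> nat) list list \<Rightarrow> bool" where
  "violated f cs \<longleftrightarrow> list_ex (list_all (\<lambda>(a, b). f b < f a)) cs"

definition conflicts :: "nat list list \<Rightarrow> (nat list \<times> nat \<times> nat) list \<Rightarrow>
    ((nat \<times> nat) list list \<times> (nat \<times> nat) list list) list" where
  "conflicts L = map (\<lambda>(T, p, q). (clauses L T p, clauses L T q))"

definition valid_pairs :: "nat list list \<Rightarrow> (nat list \<times> nat \<times> nat) list \<Rightarrow> bool" where
  "valid_pairs L = list_all (\<lambda>(T, p, q). p \<noteq> q \<and> admissible L T p \<and> admissible L T q)"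

lemma violated_if_not_satisfied:
  assumes f: "inj_on f {..<length L}" and ad: "admissible L T p" and n: "\<not> satisfied f (clauses L T p)"
  shows "violated (int \<circ> f) (clauses L T p)"
proof -
  have T: "set T \<subseteq> {..<length L}" "p < length L" "p \<notin> set T"
    using ad unfolding admissible_def list_all_iff List.member_iff by auto
  have atoms: "a < length L \<and> b < length L \<and> a \<noteq> b" if "cl \<in> set (clauses L T p)" "(a, b) \<in> set cl" for a b cl
    using that T unfolding clauses_def List.member_iff by auto
  obtain cl where cl: "cl \<in> set (clauses L T p)" "\<And>a b. (a, b) \<in> set cl \<Longrightarrow> \<not> f a < f b"
    using n unfolding satisfied_def list_all_iff list_ex_iff by blast
  have "f b < f a" if "(a, b) \<in> set cl" for a b
    using cl(2)[OF that] atoms[OF cl(1) that] inj_onD[OF f, of a b] by (auto simp: not_less order_le_less)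
  then show ?thesis using cl(1) unfolding violated_def list_all_iff list_ex_iff by fastforce
qed

text \<open>
  Each triple \<open>(T, p, q)\<close> with \<open>p \<noteq> q\<close> forces a violated clause of \<open>p\<close> or of \<open>q\<close>. If these
  requirements cannot be met simultaneously, no order is good.
\<close>

lemma unorderableI:
  assumes ok: "valid_pairs L K" and K: "conflicts L K = K'"
    and sat: "\<And>f. list_all (\<lambda>(c, d). violated f c \<or> violated f d) K' \<Longrightarrow> False"
  shows "unorderable L"
  unfolding unorderable_def
proof (intro allI impI notI)
  fix f assume f: "inj_on f {..<length L}" and u: "critical_unique (covers L) {..<length L} (rank_order f)"
  have "violated (int \<circ> f) (clauses L T p) \<or> violated (int \<circ> f) (clauses L T q)" if "(T, p, q) \<in> set K" for T p q
  proof -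
    have ad: "p \<noteq> q" "admissible L T p" "admissible L T q"
      using ok that unfolding valid_pairs_def list_all_iff by auto
    then have "\<not> (satisfied f (clauses L T p) \<and> satisfied f (clauses L T q))"
      using u critical_iff_satisfied[OF f] unfolding critical_unique_def by blast
    then show ?thesis using violated_if_not_satisfied[OF f] ad by blast
  qed
  then have "list_all (\<lambda>(c, d). violated (int \<circ> f) c \<or> violated (int \<circ> f) d) K'"
    unfolding K[symmetric] conflicts_def list_all_iff by auto
  then show False by (rule sat)
qed

text \<open>
  The check behind \<open>critical_least\<close> for the order in which the vectors are listed, smallest first. If
  position \<open>0\<close> is not covered by the other elements of \<open>T\<close>, then at some coordinate \<open>k\<close> all of them
  are smaller than the vector at position \<open>0\<close>; only these \<open>T\<close>, with and without position \<open>0\<close>, are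
  examined.
\<close>

definition friendly_as_listed :: "nat list list \<Rightarrow> bool" where
  "friendly_as_listed L \<longleftrightarrow> list_all (\<lambda>k. list_all (\<lambda>xs. list_all (\<lambda>T.
      length (filter (\<lambda>p. admissible L T p \<and> satisfied id (clauses L T p)) [0..<length L]) \<le> 1) [xs, 0 # xs])
      (subseqs (filter (\<lambda>s. s \<noteq> 0 \<and> L ! s ! k < L ! 0 ! k) [0..<length L]))) [0..<length (L ! 0)]"

lemma critical_unique_if_friendly_as_listed:
  assumes ok: "friendly_as_listed L"
  shows "critical_unique (covers L) {..<length L} (rank_order id)"
  unfolding critical_unique_def
proof (intro allI impI, elim conjE)
  let ?crit = "critical (covers L) {..<length L} (rank_order id)"
  fix T p q assume p: "?crit T p" and q: "?crit T q"
  have L0: "0 < length L" using p unfolding critical_def by auto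
  have least: "p' = 0" if "?crit T p'" "covers L (T - {0}) 0" for p'
    using L0 by (intro critical_least[where C = "covers L", OF covers_mono _ _ _ that])
      (auto simp: rank_order_def)
  show "p = q"
  proof (cases "covers L (T - {0}) 0")
    case True
    then show ?thesis using least p q by blast
  next
    case False
    then obtain k where k: "k < length (L ! 0)" "\<And>s. s \<in> T - {0} \<Longrightarrow> L ! s ! k < L ! 0 ! k"
      unfolding covers_def by (auto simp: not_le)
    let ?B = "filter (\<lambda>s. s \<noteq> 0 \<and> L ! s ! k < L ! 0 ! k) [0..<length L]"
    have TL: "T \<subseteq> {..<length L}" using p unfolding critical_def by blast
    then have "T - {0} \<subseteq> set ?B" using k(2) by auto
    then have "T - {0} \<in> set ` set (subseqs ?B)" unfolding subseqs_powset by blast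
    then obtain xs where xs: "xs \<in> set (subseqs ?B)" "set xs = T - {0}" by auto
    define T' where "T' = (if 0 \<in> T then 0 # xs else xs)"
    have T': "set T' = T" "T' \<in> set [xs, 0 # xs]" using xs(2) unfolding T'_def by auto
    let ?P = "\<lambda>p. admissible L T' p \<and> satisfied id (clauses L T' p)"
    have len: "length (filter ?P [0..<length L]) \<le> 1"
      using ok xs(1) T'(2) k(1) unfolding friendly_as_listed_def list_all_iff by auto
    have "p \<in> set (filter ?P [0..<length L])" "q \<in> set (filter ?P [0..<length L])"
      using p q critical_iff_satisfied[of id L T'] T'(1) unfolding critical_def by auto
    then show ?thesis using len
      by (cases "filter ?P [0..<length L]") auto
  qed
qed

section \<open>Minimal generators of the powers of an edge ideal\<close>

definition edge_monomial :: "'v::finite set \<Rightarrow> 'v monomial" where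
  "edge_monomial e = (\<Sum>v\<in>e. Poly_Mapping.single v 1)"

primrec edge_sums :: "'v::finite set set \<Rightarrow> nat \<Rightarrow> 'v monomial set" where
  "edge_sums E 0 = {0}"
| "edge_sums E (Suc n) = {edge_monomial e + m | e m. e \<in> E \<and> m \<in> edge_sums E n}"

lemma lookup_edge_monomial: "lookup (edge_monomial e) v = (if v \<in> e then 1 else 0)"
  unfolding edge_monomial_def by (simp add: lookup_sum lookup_single when_def)

lemma sum_lookup_edge_monomial: "(\<Sum>v\<in>S. lookup (edge_monomial e) v) = card (e \<inter> S)"
  by (simp add: lookup_edge_monomial sum.If_cases Int_commute)

lemma sum_lookup_edge_sums_le:
  assumes "m \<in> edge_sums E n" "\<And>e. e \<in> E \<Longrightarrow> card (e \<inter> S) \<le> k"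
  shows "(\<Sum>v\<in>S. lookup m v) \<le> k * n"
  using assms(1)
proof (induction n arbitrary: m)
  case (Suc n)
  then obtain e m' where m: "m = edge_monomial e + m'" "e \<in> E" "m' \<in> edge_sums E n" by auto
  have "(\<Sum>v\<in>S. lookup m v) = card (e \<inter> S) + (\<Sum>v\<in>S. lookup m' v)"
    unfolding m(1) by (simp add: lookup_add sum.distrib sum_lookup_edge_monomial)
  then show ?case using assms(2)[OF m(2)] Suc.IH[OF m(3)] by simp
qed simp

lemma sum_lookup_edge_sums_eq:
  assumes "m \<in> edge_sums E n" "\<And>e. e \<in> E \<Longrightarrow> card (e \<inter> S) = k"
  shows "(\<Sum>v\<in>S. lookup m v) = k * n"
  using assms(1)
proof (induction n arbitrary: m)
  case (Suc n)
  then obtain e m' where m: "m = edge_monomial e + m'" "e \<in> E" "m' \<in> edge_sums E n" by auto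
  have "(\<Sum>v\<in>S. lookup m v) = card (e \<inter> S) + (\<Sum>v\<in>S. lookup m' v)"
    unfolding m(1) by (simp add: lookup_add sum.distrib sum_lookup_edge_monomial)
  then show ?case using assms(2)[OF m(2)] Suc.IH[OF m(3)] by simp
qed simp

lemma degree_edge_sums:
  assumes "simple_graph E" "m \<in> edge_sums E n"
  shows "(\<Sum>v\<in>UNIV. lookup m v) = 2 * n"
  using sum_lookup_edge_sums_eq[OF assms(2), of UNIV 2] assms(1) unfolding simple_graph_def by simp

text \<open>
  An edge has at most one vertex in an independent set. Together with the degree, this is the only
  restriction on exponents that the determination of the boxes uses.
\<close>

lemma independent_edge_sums:
  assumes "simple_graph E" "m \<in> edge_sums E n" and ind: "\<And>x y. x \<in> S \<Longrightarrow> y \<in> S \<Longrightarrow> {x, y} \<notin> E"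
  shows "(\<Sum>v\<in>S. lookup m v) \<le> n"
proof -
  have "card (e \<inter> S) \<le> 1" if e: "e \<in> E" for e
  proof -
    have c2: "card e = 2" using e assms(1) unfolding simple_graph_def by blast
    then obtain x y where xy: "e = {x, y}" by (meson card_2_iff)
    then have "e \<inter> S \<noteq> e" using ind e by blast
    then have "e \<inter> S \<subset> e" by blast
    then have "card (e \<inter> S) < card e" by (intro psubset_card_mono) simp
    then show ?thesis using c2 by simp
  qed
  then show ?thesis using sum_lookup_edge_sums_le[OF assms(2), of S 1] by simp
qed

lemma finite_edge_sums: "finite (edge_sums E n)"
proof (induction n)
  case (Suc n)
  have "edge_sums E (Suc n) = (\<lambda>(e, m). edge_monomial e + m) ` (E \<times> edge_sums E n)" by auto
  then show ?case using Suc by simp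
qed simp

lemma edge_sums_add_edge: "e \<in> E \<Longrightarrow> m \<in> edge_sums E n \<Longrightarrow> edge_monomial e + m \<in> edge_sums E (Suc n)"
  by auto

text \<open>
  Products of generators generate the product ideal, by linearity in one factor and then in the other.
\<close>

lemma ideal_of_products:
  fixes A B :: "'a::comm_ring_1 set"
  shows "ideal_of {a * b | a b. a \<in> ideal_of A \<and> b \<in> ideal_of B} = ideal_of {a * b | a b. a \<in> A \<and> b \<in> B}"
    (is "?L = ?R")
proof
  interpret module "(*) :: 'a \<Rightarrow> _" by (rule module_mult)
  have 1: "a * b \<in> ?R" if a: "a \<in> A" and b: "b \<in> ideal_of B" for a b
    using b
  proof (induction rule: span_induct_alt)
    case base
    then show ?case by (simp add: span_zero)
  next
    case (step c x y)
    have "a * x \<in> ?R" using a step(1) by (intro span_base) blast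
    from span_add[OF span_scale[OF this, of c] step(2)]
    have "c * (a * x) + a * y \<in> ?R" .
    moreover have "a * (c * x + y) = c * (a * x) + a * y"
      unfolding distrib_left mult.left_commute[of a c x] by (rule refl)
    ultimately show ?case by metis
  qed
  have 2: "a * b \<in> ?R" if a: "a \<in> ideal_of A" and b: "b \<in> ideal_of B" for a b
    using a
  proof (induction rule: span_induct_alt)
    case base
    then show ?case by (simp add: span_zero)
  next
    case (step c x y)
    from span_add[OF span_scale[OF 1[OF step(1) b], of c] step(2)]
    have "c * (x * b) + y * b \<in> ?R" .
    moreover have "(c * x + y) * b = c * (x * b) + y * b"
      unfolding distrib_right mult.assoc by (rule refl)
    ultimately show ?case by metis
  qed
  show "?L \<subseteq> ?R" using 2 by (intro span_minimal subspace_span) blast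
  show "?R \<subseteq> ?L" by (intro span_mono) (use span_base in blast)
qed

lemma edge_ideal_eq:
  assumes "simple_graph E"
  shows "(edge_ideal E :: ('v::finite, 'k::field) mpoly set) = ideal_of (mono_poly ` edge_monomial ` E)"
proof -
  have pair: "Var x * Var y = (mono_poly (edge_monomial {x, y}) :: ('v, 'k) mpoly)" if "{x, y} \<in> E" for x y
  proof -
    have "card {x, y} = 2" using that assms unfolding simple_graph_def by blast
    then have "x \<noteq> y" by auto
    then show ?thesis by (simp add: Var_def edge_monomial_def mono_poly_add)
  qed
  have "{Var x * Var y | x y. {x, y} \<in> E} = (mono_poly ` edge_monomial ` E :: ('v, 'k) mpoly set)"
  proof
    show "{Var x * Var y | x y. {x, y} \<in> E} \<subseteq> (mono_poly ` edge_monomial ` E :: ('v, 'k) mpoly set)"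
      using pair by auto
    show "(mono_poly ` edge_monomial ` E :: ('v, 'k) mpoly set) \<subseteq> {Var x * Var y | x y. {x, y} \<in> E}"
    proof (rule subsetI)
      fix p :: "('v, 'k) mpoly" assume "p \<in> mono_poly ` edge_monomial ` E"
      then obtain e where e: "e \<in> E" "p = mono_poly (edge_monomial e)" by blast
      then have "card e = 2" using assms unfolding simple_graph_def by blast
      then obtain x y where "e = {x, y}" by (meson card_2_iff)
      then have "p = Var x * Var y \<and> {x, y} \<in> E" using e pair[of x y] by simp
      then show "p \<in> {Var x * Var y | x y. {x, y} \<in> E}" by blast
    qed
  qed
  then show ?thesis unfolding edge_ideal_def by simp
qed

lemma ideal_power_edge_ideal:
  assumes "simple_graph E"
  shows "ideal_power (edge_ideal E :: ('v::finite, 'k::field) mpoly set) n = ideal_of (mono_poly ` edge_sums E n)"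
proof (induction n)
  interpret module "(*) :: ('v, 'k) mpoly \<Rightarrow> _" by (rule module_mult)
  case 0
  have "(mono_poly 0 :: ('v, 'k) mpoly) = 1" by (simp add: mono_poly_def)
  then have "x \<in> ideal_of {mono_poly 0}" for x :: "('v, 'k) mpoly"
    using span_scale[OF span_base[of "1 :: ('v, 'k) mpoly" "{1}"], of x] by simp
  then show ?case by auto
next
  case (Suc n)
  have eq: "{a * b | a b. a \<in> mono_poly ` edge_monomial ` E \<and> b \<in> mono_poly ` edge_sums E n}
      = (mono_poly ` edge_sums E (Suc n) :: ('v, 'k) mpoly set)"
    (is "?P = ?Q")
  proof
    show "?P \<subseteq> ?Q"
    proof
      fix p assume "p \<in> ?P"
      then obtain e m where "e \<in> E" "m \<in> edge_sums E n" "p = mono_poly (edge_monomial e) * mono_poly m"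
        by blast
      then show "p \<in> ?Q" using edge_sums_add_edge[of e E m n] by (metis imageI mono_poly_add)
    qed
    show "?Q \<subseteq> ?P"
    proof
      fix p :: "('v, 'k) mpoly" assume "p \<in> ?Q"
      then obtain e m where "e \<in> E" "m \<in> edge_sums E n" "p = mono_poly (edge_monomial e + m)" by auto
      then show "p \<in> ?P" unfolding mono_poly_add by blast
    qed
  qed
  show ?case
    unfolding ideal_power.simps Suc.IH
    unfolding edge_ideal_eq[OF assms] ideal_of_products eq by (rule refl)
qed

text \<open>
  All sums of \<open>n\<close> edges have degree \<open>2n\<close>, so none of them properly divides another one.
\<close>

lemma Gens_edge_ideal_power:
  assumes "simple_graph E"
  shows "Gens (ideal_power (edge_ideal E :: ('v::finite, 'k::field) mpoly set) n) = edge_sums E n"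
proof -
  let ?I = "ideal_power (edge_ideal E :: ('v, 'k) mpoly set) n"
  note I = ideal_power_edge_ideal[OF assms, of n, where 'k = 'k]
  have in_I: "mono_poly m \<in> ?I \<longleftrightarrow> (\<exists>a\<in>edge_sums E n. \<exists>b. m = a + b)" for m
    unfolding I by (rule mono_poly_in_ideal_of_iff)
  have eq: "a = m" if am: "a \<in> edge_sums E n" "m \<in> edge_sums E n" "m = a + b" for a m b
  proof -
    have "(\<Sum>v\<in>UNIV. lookup b v) = 0"
      using degree_edge_sums[OF assms am(1)] degree_edge_sums[OF assms am(2)]
      unfolding am(3) by (simp add: lookup_add sum.distrib)
    then have "b = 0" by (intro poly_mapping_eqI) simp
    then show ?thesis using am(3) by simp
  qed
  have self: "mono_poly m \<in> ?I" if "m \<in> edge_sums E n" for m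
  proof -
    have "m = m + 0" by simp
    then show ?thesis using in_I that by blast
  qed
  have 1: "m \<in> edge_sums E n"
    if m: "mono_poly m \<in> ?I" and minimal: "\<And>a b. m = a + b \<Longrightarrow> mono_poly a \<in> ?I \<Longrightarrow> a = m" for m
  proof -
    from in_I[THEN iffD1, OF m] obtain a b where ab: "a \<in> edge_sums E n" "m = a + b" by blast
    then have "a = m" using minimal self by blast
    then show ?thesis using ab(1) by simp
  qed
  have 2: "a = m" if m: "m \<in> edge_sums E n" and ab: "m = a + b" and a: "mono_poly a \<in> ?I" for m a b
  proof -
    from in_I[THEN iffD1, OF a] obtain c d where cd: "c \<in> edge_sums E n" "a = c + d" by blast
    have mc: "m = c + (d + b)" using ab cd(2) by (simp add: add.assoc)
    have "c = m" using eq[OF cd(1) m mc] .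
    then have "d + b = 0" using mc by simp
    then have "lookup d v + lookup b v = 0" for v by (metis lookup_add lookup_zero)
    then have "b = 0" by (intro poly_mapping_eqI) simp
    then show ?thesis using ab by simp
  qed
  have "Gens ?I = {m. mono_poly m \<in> ?I \<and> (\<forall>a b. m = a + b \<and> mono_poly a \<in> ?I \<longrightarrow> a = m)}"
    by (rule Gens_monomial_ideal(2)[OF I])
  also have "\<dots> = edge_sums E n"
  proof
    show "{m. mono_poly m \<in> ?I \<and> (\<forall>a b. m = a + b \<and> mono_poly a \<in> ?I \<longrightarrow> a = m)} \<subseteq> edge_sums E n"
      using 1 by auto
    show "edge_sums E n \<subseteq> {m. mono_poly m \<in> ?I \<and> (\<forall>a b. m = a + b \<and> mono_poly a \<in> ?I \<longrightarrow> a = m)}"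
      using 2 self by auto
  qed
  finally show ?thesis .
qed

definition orderable :: "'v::finite monomial set \<Rightarrow> bool" where
  "orderable M \<longleftrightarrow> (\<exists>r. strict_linear_order_on M r \<and> critical_unique cov M r)"

lemma bridge_friendly_iff_orderable:
  assumes "simple_graph E" "n > 0"
  shows "bridge_friendly (ideal_power (edge_ideal E :: ('v::finite, 'k::field) mpoly set) n)
    \<longleftrightarrow> orderable (edge_sums E n)"
proof -
  have "0 \<notin> edge_sums E n" using degree_edge_sums[OF assms(1), of 0 n] assms(2) by auto
  note iff = all_type2_iff_critical_unique[OF finite_edge_sums this]
  show ?thesis
    unfolding bridge_friendly_def bridge_friendly_wrt_def orderable_def Gens_edge_ideal_power[OF assms(1)]
    by (intro ex_cong1 conj_cong refl iff)
qed

section \<open>Monomials on a list of vertices\<close>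

definition mon :: "'v::finite list \<Rightarrow> nat list \<Rightarrow> 'v monomial" where
  "mon vs xs = (\<Sum>k<length vs. Poly_Mapping.single (vs ! k) (xs ! k))"

lemma lookup_mon:
  assumes "distinct vs" "k < length vs"
  shows "lookup (mon vs xs) (vs ! k) = xs ! k"
proof -
  have "lookup (mon vs xs) (vs ! k) = (\<Sum>j<length vs. if j = k then xs ! j else 0)"
    unfolding mon_def lookup_sum lookup_single when_def
    using nth_eq_iff_index_eq[OF assms(1) _ assms(2)] by (intro sum.cong) auto
  then show ?thesis using assms(2) by simp
qed

lemma lookup_mon_outside: "v \<notin> set vs \<Longrightarrow> lookup (mon vs xs) v = 0"
  unfolding mon_def lookup_sum lookup_single by (auto simp: when_def intro!: sum.neutral)

lemma mon_eqI:
  assumes "distinct vs" "\<And>v. v \<notin> set vs \<Longrightarrow> lookup m v = 0"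
    and "\<And>k. k < length vs \<Longrightarrow> lookup m (vs ! k) = xs ! k"
  shows "m = mon vs xs"
proof (rule poly_mapping_eqI)
  fix v show "lookup m v = lookup (mon vs xs) v"
    using assms lookup_mon[OF assms(1)] lookup_mon_outside[of v vs xs] by (metis in_set_conv_nth)
qed

definition edge_vec :: "nat \<Rightarrow> nat \<times> nat \<Rightarrow> nat list" where
  "edge_vec d = (\<lambda>(i, j). map (\<lambda>k. if k = i \<or> k = j then 1 else 0) [0..<d])"

text \<open>
  The computable counterpart of \<open>edge_sums\<close>, for edges given by pairs of positions in a list of vertices.
\<close>

primrec edge_vec_sums :: "nat \<Rightarrow> (nat \<times> nat) list \<Rightarrow> nat \<Rightarrow> nat list list" where
  "edge_vec_sums d es 0 = [replicate d 0]"
| "edge_vec_sums d es (Suc n) =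
     remdups (concat (map (\<lambda>e. map (map2 (+) (edge_vec d e)) (edge_vec_sums d es n)) es))"

definition edges_of :: "'v set set \<Rightarrow> 'v list \<Rightarrow> (nat \<times> nat) list \<Rightarrow> bool" where
  "edges_of E vs es \<longleftrightarrow>
     list_all (\<lambda>(i, j). i < length vs \<and> j < length vs \<and> {vs ! i, vs ! j} \<in> E) es"

lemma mon_add_edge:
  assumes vs: "distinct vs" and ij: "i < length vs" "j < length vs" and len: "length xs = length vs"
  shows "mon vs (map2 (+) (edge_vec (length vs) (i, j)) xs) = edge_monomial {vs ! i, vs ! j} + mon vs xs"
proof (rule mon_eqI[OF vs, symmetric])
  show "lookup (edge_monomial {vs ! i, vs ! j} + mon vs xs) v = 0" if "v \<notin> set vs" for v
    using that ij nth_mem[of _ vs] lookup_mon_outside[OF that, of xs]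
    by (auto simp: lookup_add lookup_edge_monomial)
  fix k assume k: "k < length vs"
  show "lookup (edge_monomial {vs ! i, vs ! j} + mon vs xs) (vs ! k)
      = map2 (+) (edge_vec (length vs) (i, j)) xs ! k"
    using k ij len nth_eq_iff_index_eq[OF vs k]
    by (simp add: lookup_add lookup_edge_monomial lookup_mon[OF vs k] edge_vec_def)
qed

lemma length_edge_vec: "length (edge_vec d e) = d"
  unfolding edge_vec_def by (cases e) simp

lemma length_edge_vec_sums: "xs \<in> set (edge_vec_sums d es n) \<Longrightarrow> length xs = d"
  by (induction n arbitrary: xs) (auto simp: length_edge_vec)

lemma mon_edge_vec_sums:
  assumes vs: "distinct vs" and es: "edges_of E vs es" and xs: "xs \<in> set (edge_vec_sums (length vs) es n)"
  shows "mon vs xs \<in> edge_sums E n"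
  using xs
proof (induction n arbitrary: xs)
  case 0
  have "mon vs xs = 0" using 0 unfolding mon_def by simp
  then show ?case by simp
next
  case (Suc n)
  then obtain i j ys where y: "(i, j) \<in> set es" "ys \<in> set (edge_vec_sums (length vs) es n)"
    "xs = map2 (+) (edge_vec (length vs) (i, j)) ys" by auto
  have ij: "i < length vs" "j < length vs" "{vs ! i, vs ! j} \<in> E"
    using es y(1) unfolding edges_of_def list_all_iff by auto
  show ?case
    unfolding y(3) mon_add_edge[OF vs ij(1,2) length_edge_vec_sums[OF y(2)]]
    by (rule edge_sums_add_edge[OF ij(3) Suc.IH[OF y(2)]])
qed

text \<open>
  The exponent vector after multiplication by the \<open>j\<close>-th power of the edge \<open>e\<close>. Multiplication by a
  fixed monomial does not affect which lcms of nonempty sets are divisible by which generators, so one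
  list of vectors serves all sufficiently large exponents \<open>n\<close>.
\<close>

definition shift :: "nat \<Rightarrow> nat \<times> nat \<Rightarrow> nat list \<Rightarrow> nat list" where
  "shift j e xs = map2 (+) (map ((*) j) (edge_vec (length xs) e)) xs"

lemma length_shift: "length (shift j e xs) = length xs"
  unfolding shift_def by (simp add: length_edge_vec)

lemma nth_shift: "k < length xs \<Longrightarrow> shift j (a, b) xs ! k = (if k = a \<or> k = b then j else 0) + xs ! k"
  unfolding shift_def edge_vec_def by simp

lemma mon_shift:
  assumes vs: "distinct vs" and es: "edges_of E vs es" and e: "(a, b) \<in> set es"
    and len: "length xs = length vs" and xs: "mon vs xs \<in> edge_sums E n"
  shows "mon vs (shift j (a, b) xs) \<in> edge_sums E (j + n)"
proof (induction j)
  case 0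
  have "shift 0 (a, b) xs = xs" by (intro nth_equalityI) (auto simp: length_shift nth_shift)
  then show ?case using xs by simp
next
  case (Suc j)
  have ab: "a < length vs" "b < length vs" "{vs ! a, vs ! b} \<in> E"
    using es e unfolding edges_of_def list_all_iff by auto
  have "shift (Suc j) (a, b) xs = map2 (+) (edge_vec (length vs) (a, b)) (shift j (a, b) xs)"
    using len by (intro nth_equalityI) (auto simp: length_shift nth_shift length_edge_vec edge_vec_def)
  then show ?case
    using edge_sums_add_edge[OF ab(3) Suc.IH] mon_add_edge[OF vs ab(1,2), of "shift j (a, b) xs"] len
    by (simp add: length_shift)
qed

lemma covers_iff_cov_mon_shift:
  assumes vs: "distinct vs" "vs \<noteq> []" and len: "\<And>xs. xs \<in> set L \<Longrightarrow> length xs = length vs"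
    and S: "S \<subseteq> {..<length L}" and x: "x \<in> {..<length L}"
  shows "covers L S x \<longleftrightarrow> cov ((\<lambda>i. mon vs (shift j (a, b) (L ! i))) ` S) (mon vs (shift j (a, b) (L ! x)))"
proof -
  let ?e = "\<lambda>i. mon vs (shift j (a, b) (L ! i))"
  have len': "length (L ! i) = length vs" if "i \<in> {..<length L}" for i using that len by simp
  have at: "lookup (?e i) (vs ! k) = (if k = a \<or> k = b then j else 0) + L ! i ! k"
    if "i \<in> {..<length L}" "k < length vs" for i k
    using that len'[OF that(1)] by (simp only: lookup_mon[OF vs(1)] nth_shift)
  have le: "lookup (?e x) (vs ! k) \<le> lookup (?e s) (vs ! k) \<longleftrightarrow> L ! x ! k \<le> L ! s ! k"
    if "s \<in> S" "k < length vs" for s k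
    using at[OF x that(2)] at[OF _ that(2), of s] that(1) S by auto
  show ?thesis
  proof
    assume c: "covers L S x"
    show "cov (?e ` S) (?e x)"
      unfolding cov_def
    proof
      fix v
      show "\<exists>s\<in>?e ` S. lookup (?e x) v \<le> lookup s v"
      proof (cases "v \<in> set vs")
        case True
        then obtain k where k: "k < length vs" "v = vs ! k" by (metis in_set_conv_nth)
        then obtain s where "s \<in> S" "L ! x ! k \<le> L ! s ! k"
          using c len'[OF x] unfolding covers_def by auto
        then show ?thesis using le k by blast
      next
        case False
        have "0 < length (L ! x)" using vs(2) len'[OF x] by simp
        then obtain s where "s \<in> S" using c unfolding covers_def by blast
        then show ?thesis using lookup_mon_outside[OF False] by auto
      qed
    qed
  next
    assume c: "cov (?e ` S) (?e x)"
    show "covers L S x"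
      unfolding covers_def len'[OF x]
    proof (intro allI impI)
      fix k assume k: "k < length vs"
      obtain s where "s \<in> S" "lookup (?e x) (vs ! k) \<le> lookup (?e s) (vs ! k)"
        using c unfolding cov_def by blast
      then show "\<exists>s\<in>S. L ! x ! k \<le> L ! s ! k" using le k by blast
    qed
  qed
qed

lemma inj_on_mon_shift:
  assumes vs: "distinct vs" and len: "\<And>xs. xs \<in> set L \<Longrightarrow> length xs = length vs" and L: "distinct L"
  shows "inj_on (\<lambda>i. mon vs (shift j (a, b) (L ! i))) {..<length L}"
proof (rule inj_onI)
  fix x y assume xy: "x \<in> {..<length L}" "y \<in> {..<length L}"
    and eq: "mon vs (shift j (a, b) (L ! x)) = mon vs (shift j (a, b) (L ! y))"
  have l: "length (L ! x) = length vs" "length (L ! y) = length vs" using xy len by auto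
  have "L ! x ! k = L ! y ! k" if k: "k < length vs" for k
    using arg_cong[OF eq, of "\<lambda>m. lookup m (vs ! k)"] l k by (simp add: lookup_mon[OF vs k] nth_shift)
  then have "L ! x = L ! y" using l by (intro nth_equalityI) auto
  then show "x = y" using L xy by (simp add: nth_eq_iff_index_eq)
qed

text \<open>
  An order on \<open>M\<close> induces a rank on the positions of \<open>L\<close>, namely the number of smaller elements.
\<close>

lemma not_orderable_if_unorderable:
  assumes un: "unorderable L"
    and vs: "distinct vs" "vs \<noteq> []" and len: "\<And>xs. xs \<in> set L \<Longrightarrow> length xs = length vs" and L: "distinct L"
    and box: "\<And>m. m \<in> (\<lambda>xs. mon vs (shift j (a, b) xs)) ` set L \<longleftrightarrow> m \<in> M \<and> (\<forall>v. lookup m v \<le> u v)"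
  shows "\<not> orderable M"
proof
  assume "orderable M"
  then obtain r where r: "strict_linear_order_on M r" and cu: "critical_unique cov M r"
    unfolding orderable_def by blast
  let ?X = "{..<length L}" and ?e = "\<lambda>i. mon vs (shift j (a, b) (L ! i))"
  define f where "f x = card {y \<in> ?X. (?e x, ?e y) \<in> r}" for x
  have inj: "inj_on ?e ?X" using inj_on_mon_shift[OF vs(1) len L] .
  have "?e ` ?X = (\<lambda>xs. mon vs (shift j (a, b) xs)) ` set L"
    unfolding set_conv_nth by auto
  then have down: "?e ` ?X = {m \<in> M. \<forall>v. lookup m v \<le> u v}" using box by auto
  have eM: "?e x \<in> M" if "x \<in> ?X" for x
    using imageI[OF that, of ?e] unfolding down by simp
  have less: "f y < f x" if xy: "x \<in> ?X" "y \<in> ?X" "(?e x, ?e y) \<in> r" for x y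
    unfolding f_def
  proof (rule psubset_card_mono)
    show "{z \<in> ?X. (?e y, ?e z) \<in> r} \<subset> {z \<in> ?X. (?e x, ?e z) \<in> r}"
    proof
      show "{z \<in> ?X. (?e y, ?e z) \<in> r} \<subseteq> {z \<in> ?X. (?e x, ?e z) \<in> r}"
        using strict_linear_order_on_transD[OF r xy(3)] by auto
      show "{z \<in> ?X. (?e y, ?e z) \<in> r} \<noteq> {z \<in> ?X. (?e x, ?e z) \<in> r}"
        using xy strict_linear_order_on_irreflD[OF r] by auto
    qed
  qed simp
  have tot: "(?e x, ?e y) \<in> r \<or> (?e y, ?e x) \<in> r" if "x \<in> ?X" "y \<in> ?X" "x \<noteq> y" for x y
    using strict_linear_order_on_totalD[OF r eM[OF that(1)] eM[OF that(2)]] inj that by (auto dest: inj_onD)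
  have rk: "(x, y) \<in> rank_order f \<longleftrightarrow> (?e x, ?e y) \<in> r" if xy: "x \<in> ?X" "y \<in> ?X" for x y
    using less[OF xy] less[OF xy(2,1)] tot[OF xy] unfolding rank_order_def by fastforce
  have "inj_on f ?X"
  proof (rule inj_onI)
    fix x y assume xy: "x \<in> ?X" "y \<in> ?X" "f x = f y"
    then show "x = y" using less[OF xy(1,2)] less[OF xy(2,1)] tot[OF xy(1,2)] by fastforce
  qed
  moreover have "critical_unique (covers L) ?X (rank_order f)"
    using critical_unique_restrict[OF inj down covers_iff_cov_mon_shift[OF vs len] rk cu] .
  ultimately show False using un unfolding unorderable_def by blast
qed

lemma strict_linear_order_on_rank:
  assumes "inj_on (f :: 'a \<Rightarrow> nat) M"
  shows "strict_linear_order_on M {(x, y). f y < f x}"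
  unfolding strict_linear_order_on_def trans_def irrefl_def total_on_def
  using inj_onD[OF assms] by (auto, metis linorder_neq_iff)

lemma orderable_if_friendly_as_listed:
  assumes ok: "friendly_as_listed L"
    and vs: "distinct vs" "vs \<noteq> []" and len: "\<And>xs. xs \<in> set L \<Longrightarrow> length xs = length vs" and L: "distinct L"
    and M: "M = mon vs ` set L"
  shows "orderable M"
proof -
  let ?X = "{..<length L}" and ?e = "\<lambda>i. mon vs (L ! i)"
  have s0: "shift 0 (0, 0) xs = xs" for xs
    by (intro nth_equalityI) (auto simp: length_shift nth_shift)
  have inj: "inj_on ?e ?X" using inj_on_mon_shift[OF vs(1) len L, of 0 0 0] unfolding s0 .
  have eX: "?e ` ?X = M" unfolding M set_conv_nth by auto
  define idx where "idx = inv_into ?X ?e"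
  have idx: "idx (?e x) = x" if "x \<in> ?X" for x using inv_into_f_f[OF inj that] unfolding idx_def .
  define r where "r = {(x, y). idx y < idx x}"
  have "inj_on idx M" unfolding idx_def using inj_on_inv_into[of M ?e ?X] eX by simp
  then have lin: "strict_linear_order_on M r" unfolding r_def by (rule strict_linear_order_on_rank)
  have rk: "(x, y) \<in> rank_order id \<longleftrightarrow> (?e x, ?e y) \<in> r" if "x \<in> ?X" "y \<in> ?X" for x y
    using idx that unfolding r_def rank_order_def by simp
  have cv: "covers L S x \<longleftrightarrow> cov (?e ` S) (?e x)" if "S \<subseteq> ?X" "x \<in> ?X" for S x
    using covers_iff_cov_mon_shift[OF vs len that, of 0 0 0] unfolding s0 .
  \<comment> \<open>Any common bound of the exponents would do.\<close>
  have bnd: "lookup m v \<le> (\<Sum>m\<in>M. \<Sum>v\<in>UNIV. lookup m v)" if "m \<in> M" for m v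
  proof -
    have "lookup m v \<le> (\<Sum>v\<in>UNIV. lookup m v)" by (intro member_le_sum) auto
    also have "\<dots> \<le> (\<Sum>m\<in>M. \<Sum>v\<in>UNIV. lookup m v)"
      using that by (intro member_le_sum[of m M "\<lambda>m. \<Sum>v\<in>UNIV. lookup m v"]) (auto simp: M)
    finally show ?thesis .
  qed
  have "critical_unique cov M r"
    using critical_unique_extend[OF inj eX cv rk bnd critical_unique_if_friendly_as_listed[OF ok]] .
  then show ?thesis using lin unfolding orderable_def by blast
qed

lemma orderable_if_injective_or_constant:
  assumes "finite M" "0 \<notin> M"
    and "\<And>v. (\<forall>m\<in>M. \<forall>m'\<in>M. lookup m v = lookup m' v) \<or> inj_on (\<lambda>m. lookup m v) M"
  shows "orderable M"
proof -
  obtain f :: "_ \<Rightarrow> nat" where "inj_on f M" using finite_imp_inj_to_nat_seg[OF assms(1)] by blast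
  then have "strict_linear_order_on M {(x, y). f y < f x}" by (rule strict_linear_order_on_rank)
  then show ?thesis
    using critical_unique_if_injective_or_constant[OF assms(1,2) _ assms(3)] unfolding orderable_def by blast
qed

lemma list_all_ex_simps:
  "list_ex P [] = False" "list_ex P (x # xs) \<longleftrightarrow> P x \<or> list_ex P xs"
  "list_all P [] = True" "list_all P (x # xs) \<longleftrightarrow> P x \<and> list_all P xs"
  by simp_all

section \<open>Boxes that admit no order\<close>

text \<open>
  Each of the following lists is, for a suitable graph and up to multiplication by a power of an edge,
  the set of generators dividing a fixed monomial. The entries \<open>(T, p, q)\<close> of the certificates refer to
  positions in the list; the clauses computed from them form the unspecified right-hand sides.

  In the smallest cases the certificate can be read directly. For \<open>path4_box\<close> the pairs of positions
  \<open>{0, 3}\<close> and \<open>{1, 2}\<close> have the same lcm, which all four elements divide. The first triple forces the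
  smallest of the four elements into \<open>{1, 2}\<close> and the second one forces it into \<open>{0, 3}\<close>. For
  \<open>star_box2\<close>, the positions \<open>1, 3, 4\<close> are the products of two different leaves, and the three triples
  force the smallest of these into \<open>{1, 3}\<close>, \<open>{3, 4}\<close> and \<open>{1, 4}\<close>, which have no common element.
\<close>

definition path4_box :: "nat list list" where
  "path4_box =
    [[0, 1, 2, 1], [0, 2, 2, 0], [1, 1, 1, 1], [1, 2, 1, 0]]"

schematic_goal conflicts_path4_box:
  "conflicts path4_box
    [([0, 3], 1, 2), ([1, 2], 0, 3)] = ?C"
  by code_simp

lemma unorderable_path4_box: "unorderable path4_box"
proof (rule unorderableI[OF _ conflicts_path4_box], goal_cases)
  case 1
  show ?case by code_simp
next
  case (2 f)
  then show ?case unfolding violated_def list_all_ex_simps split by (smt (verit))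
qed

definition star_box2 :: "nat list list" where
  "star_box2 =
    [[2, 0, 0, 2], [2, 0, 1, 1], [2, 0, 2, 0], [2, 1, 0, 1], [2, 1, 1, 0], [2, 2, 0, 0]]"

schematic_goal conflicts_star_box2:
  "conflicts star_box2
    [([0, 4], 1, 3), ([1, 5], 3, 4), ([2, 3], 1, 4)] = ?C"
  by code_simp

lemma unorderable_star_box2: "unorderable star_box2"
proof (rule unorderableI[OF _ conflicts_star_box2], goal_cases)
  case 1
  show ?case by code_simp
next
  case (2 f)
  then show ?case unfolding violated_def list_all_ex_simps split by (smt (verit))
qed

definition star_box3 :: "nat list list" where
  "star_box3 =
    [[3, 0, 1, 2], [3, 0, 2, 1], [3, 1, 0, 2], [3, 1, 1, 1], [3, 1, 2, 0], [3, 2, 0, 1],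
     [3, 2, 1, 0], [3, 3, 0, 0]]"

schematic_goal conflicts_star_box3:
  "conflicts star_box3
    [([0, 5], 2, 6), ([1, 6], 4, 5), ([2, 6], 0, 5), ([2, 6], 3, 5), ([3, 7], 5, 6),
     ([4, 5], 1, 6), ([4, 5], 3, 6)] = ?C"
  by code_simp

lemma unorderable_star_box3: "unorderable star_box3"
proof (rule unorderableI[OF _ conflicts_star_box3], goal_cases)
  case 1
  show ?case by code_simp
next
  case (2 f)
  then show ?case unfolding violated_def list_all_ex_simps split by (smt (verit))
qed

text \<open>
  The vectors of \<open>star_box3\<close> multiplied by an edge, and one more vector at the last position, which
  does not occur in the certificate.
\<close>

definition star_box4 :: "nat list list" where
  "star_box4 =
    [[4, 1, 1, 2], [4, 1, 2, 1], [4, 2, 0, 2], [4, 2, 1, 1], [4, 2, 2, 0], [4, 3, 0, 1],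
     [4, 3, 1, 0], [4, 4, 0, 0], [4, 0, 2, 2]]"

schematic_goal conflicts_star_box4:
  "conflicts star_box4
    [([0, 5], 2, 6), ([1, 6], 4, 5), ([2, 6], 0, 5), ([2, 6], 3, 5), ([3, 7], 5, 6),
     ([4, 5], 1, 6), ([4, 5], 3, 6)] = ?C"
  by code_simp

lemma unorderable_star_box4: "unorderable star_box4"
proof (rule unorderableI[OF _ conflicts_star_box4], goal_cases)
  case 1
  show ?case by code_simp
next
  case (2 f)
  then show ?case unfolding violated_def list_all_ex_simps split by (smt (verit))
qed

definition paw_box :: "nat list list" where
  "paw_box =
    [[0, 0, 2, 2], [0, 1, 2, 1], [1, 0, 2, 1], [1, 1, 1, 1], [1, 1, 2, 0], [2, 0, 2, 0],
     [2, 1, 1, 0]]"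

schematic_goal conflicts_paw_box:
  "conflicts paw_box
    [([0, 3], 1, 2), ([0, 4], 1, 2), ([1, 5], 2, 4), ([1, 6], 3, 4), ([2, 6], 3, 4),
     ([2, 6], 3, 5), ([3, 5], 2, 6)] = ?C"
  by code_simp

lemma unorderable_paw_box: "unorderable paw_box"
proof (rule unorderableI[OF _ conflicts_paw_box], goal_cases)
  case 1
  show ?case by code_simp
next
  case (2 f)
  then show ?case unfolding violated_def list_all_ex_simps split by (smt (verit))
qed

definition diamond_box :: "nat list list" where
  "diamond_box =
    [[0, 2, 1, 1], [1, 1, 1, 1], [1, 2, 0, 1], [1, 2, 1, 0], [2, 0, 1, 1], [2, 1, 0, 1],
     [2, 1, 1, 0], [2, 2, 0, 0]]"

schematic_goal conflicts_diamond_box: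
  "conflicts diamond_box
    [([0, 5], 1, 2), ([0, 6], 1, 3), ([0, 6], 3, 4), ([0, 6], 4, 7), ([0, 7], 2, 3),
     ([1, 7], 2, 3), ([1, 7], 2, 5), ([1, 7], 2, 6), ([1, 7], 3, 5), ([1, 7], 3, 6),
     ([1, 7], 5, 6), ([2, 4], 0, 5), ([2, 4], 0, 7), ([2, 4], 1, 5), ([2, 6], 1, 3),
     ([2, 6], 1, 5), ([2, 6], 1, 7), ([2, 6], 3, 5), ([2, 6], 3, 7), ([2, 6], 5, 7),
     ([3, 4], 1, 6), ([3, 5], 1, 2), ([3, 5], 1, 6), ([3, 5], 1, 7), ([3, 5], 2, 6),
     ([3, 5], 2, 7), ([3, 5], 6, 7), ([4, 7], 5, 6)] = ?C"
  by code_simp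

lemma unorderable_diamond_box: "unorderable diamond_box"
proof (rule unorderableI[OF _ conflicts_diamond_box], goal_cases)
  case 1
  show ?case by code_simp
next
  case (2 f)
  then show ?case unfolding violated_def list_all_ex_simps split by (smt (verit))
qed

definition triangle_box :: "nat list list" where
  "triangle_box =
    [[0, 4, 4], [1, 3, 4], [1, 4, 3], [2, 2, 4], [2, 3, 3], [2, 4, 2], [3, 1, 4], [3, 2, 3],
     [3, 3, 2], [3, 4, 1], [4, 0, 4], [4, 1, 3], [4, 2, 2], [4, 3, 1], [4, 4, 0]]"

schematic_goal conflicts_triangle_box:
  "conflicts triangle_box
    [([1, 7], 3, 8), ([1, 7], 6, 8), ([2, 8], 5, 7), ([2, 8], 7, 9), ([3, 8], 1, 6),
     ([3, 8], 1, 7), ([3, 8], 4, 6), ([3, 8], 4, 7), ([4, 6], 1, 8), ([4, 6], 3, 8),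
     ([4, 9], 2, 7), ([4, 9], 5, 7), ([4, 12], 7, 8), ([4, 12], 7, 13), ([4, 12], 8, 11),
     ([4, 12], 11, 13), ([5, 7], 2, 8), ([5, 7], 2, 9), ([5, 7], 4, 8), ([5, 7], 4, 9),
     ([7, 13], 4, 11), ([7, 13], 4, 12), ([8, 11], 4, 12), ([8, 11], 4, 13)] = ?C"
  by code_simp

lemma unorderable_triangle_box: "unorderable triangle_box"
proof (rule unorderableI[OF _ conflicts_triangle_box], goal_cases)
  case 1
  show ?case by code_simp
next
  case (2 f)
  then show ?case unfolding violated_def list_all_ex_simps split by (smt (verit))
qed

section \<open>Graphs whose powers have a box without order\<close>

definition box_certificate :: "nat \<Rightarrow> (nat \<times> nat) list \<Rightarrow> nat \<Rightarrow> nat list \<Rightarrow> nat list list \<Rightarrow> bool" where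
  "box_certificate d es k ub L \<longleftrightarrow> distinct L \<and> length ub = d \<and>
     list_all (\<lambda>xs. length xs = d \<and> list_all2 (\<le>) xs ub \<and> List.member (edge_vec_sums d es k) xs) L"

text \<open>
  The vectors are sums of \<open>k\<close> edges and at most \<open>ub\<close>, so their shifts are generators in the box below
  the shift of \<open>ub\<close>. That the box contains nothing else is the premise \<open>down\<close>, to be shown from the
  shape of the graph.
\<close>

lemma not_orderable_edge_sums:
  assumes un: "unorderable L" and ok: "box_certificate d es k ub L"
    and vs: "distinct vs" "length vs = d" "0 < d" and es: "edges_of E vs es" and ab: "(a, b) \<in> set es"
    and down: "\<And>m. m \<in> edge_sums E (j + k) \<Longrightarrow> \<forall>v. v \<notin> set vs \<longrightarrow> lookup m v = 0 \<Longrightarrow>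
      \<forall>i<d. lookup m (vs ! i) \<le> (if i = a \<or> i = b then j else 0) + ub ! i \<Longrightarrow>
      \<exists>xs\<in>set L. \<forall>i<d. lookup m (vs ! i) = (if i = a \<or> i = b then j else 0) + xs ! i"
  shows "\<not> orderable (edge_sums E (j + k))"
proof (rule not_orderable_if_unorderable[OF un vs(1),
      where j = j and a = a and b = b and u = "lookup (mon vs (shift j (a, b) ub))"])
  have Lp: "length xs = d" "list_all2 (\<le>) xs ub" "xs \<in> set (edge_vec_sums d es k)"
    if "xs \<in> set L" for xs
    using ok that unfolding box_certificate_def list_all_iff List.member_iff by auto
  have ub: "length ub = d" using ok unfolding box_certificate_def by simp
  show "vs \<noteq> []" using vs by auto
  show "length xs = length vs" if "xs \<in> set L" for xs using Lp(1)[OF that] vs(2) by simp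
  show "distinct L" using ok unfolding box_certificate_def by simp
  fix m
  show "m \<in> (\<lambda>xs. mon vs (shift j (a, b) xs)) ` set L \<longleftrightarrow>
    m \<in> edge_sums E (j + k) \<and> (\<forall>v. lookup m v \<le> lookup (mon vs (shift j (a, b) ub)) v)"
    (is "_ \<longleftrightarrow> _ \<and> (\<forall>v. _ \<le> ?u v)")
  proof
    assume "m \<in> (\<lambda>xs. mon vs (shift j (a, b) xs)) ` set L"
    then obtain xs where xs: "xs \<in> set L" "m = mon vs (shift j (a, b) xs)" by blast
    have mE: "m \<in> edge_sums E (j + k)"
      unfolding xs(2)
      using mon_shift[OF vs(1) es ab] mon_edge_vec_sums[OF vs(1) es] Lp[OF xs(1)] vs(2) by simp
    have "lookup m v \<le> ?u v" for v
    proof (cases "v \<in> set vs")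
      case True
      then obtain i where i: "i < length vs" "v = vs ! i" by (metis in_set_conv_nth)
      have "xs ! i \<le> ub ! i" using Lp(2)[OF xs(1)] i(1) ub vs(2) by (simp add: list_all2_conv_all_nth)
      then show ?thesis
        unfolding i(2) xs(2) lookup_mon[OF vs(1) i(1)] using i(1) Lp(1)[OF xs(1)] ub vs(2) by (simp add: nth_shift)
    next
      case False
      then show ?thesis unfolding xs(2) by (simp add: lookup_mon_outside)
    qed
    then show "m \<in> edge_sums E (j + k) \<and> (\<forall>v. lookup m v \<le> ?u v)" using mE by blast
  next
    assume m: "m \<in> edge_sums E (j + k) \<and> (\<forall>v. lookup m v \<le> ?u v)"
    then have out: "\<forall>v. v \<notin> set vs \<longrightarrow> lookup m v = 0" using lookup_mon_outside by (metis le_zero_eq)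
    have "\<forall>i<d. lookup m (vs ! i) \<le> (if i = a \<or> i = b then j else 0) + ub ! i"
    proof (intro allI impI)
      fix i assume "i < d"
      then have i: "i < length vs" and "i < length ub" using ub vs(2) by simp_all
      from nth_shift[OF this(2), of j a b] show "lookup m (vs ! i) \<le> (if i = a \<or> i = b then j else 0) + ub ! i"
        using m lookup_mon[OF vs(1) i, of "shift j (a, b) ub"] by metis
    qed
    from down[OF conjunct1[OF m] out this] obtain xs where xs: "xs \<in> set L"
      "\<forall>i<d. lookup m (vs ! i) = (if i = a \<or> i = b then j else 0) + xs ! i" by blast
    have "m = mon vs (shift j (a, b) xs)"
      using out xs(2) Lp(1)[OF xs(1)] vs(2) by (intro mon_eqI[OF vs(1)]) (auto simp: nth_shift)
    then show "m \<in> (\<lambda>xs. mon vs (shift j (a, b) xs)) ` set L" using xs(1) by blast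
  qed
qed

lemma all_less_3: "(\<forall>i<3. P i) \<longleftrightarrow> P 0 \<and> P 1 \<and> P (2::nat)"
  by (auto simp: numeral_eq_Suc All_less_Suc)

lemma all_less_4: "(\<forall>i<4. P i) \<longleftrightarrow> P 0 \<and> P 1 \<and> P 2 \<and> P (3::nat)"
  by (auto simp: numeral_eq_Suc All_less_Suc)

lemma singleton_not_edge: "simple_graph E \<Longrightarrow> {x} \<notin> E"
  unfolding simple_graph_def by force

lemma degree_supported:
  assumes "simple_graph E" "m \<in> edge_sums E n" "\<forall>v. v \<notin> set vs \<longrightarrow> lookup m v = 0" "distinct vs"
  shows "(\<Sum>v\<leftarrow>vs. lookup m v) = 2 * n"
proof -
  have "(\<Sum>v\<leftarrow>vs. lookup m v) = (\<Sum>v\<in>set vs. lookup m v)"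
    using assms(4) by (simp add: sum_list_distinct_conv_sum_set)
  also have "\<dots> = (\<Sum>v\<in>UNIV. lookup m v)" using assms(3) by (intro sum.mono_neutral_left) auto
  finally show ?thesis using degree_edge_sums[OF assms(1,2)] by simp
qed

lemma lookup_edge_sums_le: "simple_graph E \<Longrightarrow> m \<in> edge_sums E n \<Longrightarrow> lookup m v \<le> n"
  using independent_edge_sums[of E m n "{v}"] singleton_not_edge by fastforce

lemma independent_pair:
  assumes "simple_graph E" "m \<in> edge_sums E n" "x \<noteq> y" "{x, y} \<notin> E"
  shows "lookup m x + lookup m y \<le> n"
proof -
  have "{y, x} \<notin> E" using assms(4) by (simp add: insert_commute)
  then have "(\<Sum>v\<in>{x, y}. lookup m v) \<le> n"
    using assms(4) singleton_not_edge[OF assms(1)] by (intro independent_edge_sums[OF assms(1,2)]) auto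
  then show ?thesis using assms(3) by simp
qed

lemma independent_triple:
  assumes "simple_graph E" "m \<in> edge_sums E n" "distinct [x, y, z]" "{x, y} \<notin> E" "{x, z} \<notin> E" "{y, z} \<notin> E"
  shows "lookup m x + lookup m y + lookup m z \<le> n"
proof -
  have "{y, x} \<notin> E" "{z, x} \<notin> E" "{z, y} \<notin> E" using assms(4-6) by (simp_all add: insert_commute)
  then have "(\<Sum>v\<in>{x, y, z}. lookup m v) \<le> n"
    using assms(4-6) singleton_not_edge[OF assms(1)] by (intro independent_edge_sums[OF assms(1,2)]) auto
  then show ?thesis using assms(3) by simp
qed

text \<open>
  Covers induced paths and 4-cycles alike: an edge \<open>{a, d}\<close> would be harmless, because \<open>{a, c}\<close> and
  \<open>{b, d}\<close> are independent and the exponents at \<open>a\<close> and \<open>d\<close> determine the others.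
\<close>

lemma path4_not_orderable:
  assumes E: "simple_graph E" and n: "n \<ge> 2" and d: "distinct [a, b, c, d]"
    and e: "{a, b} \<in> E" "{b, c} \<in> E" "{c, d} \<in> E" and ne: "{a, c} \<notin> E" "{b, d} \<notin> E"
  shows "\<not> orderable (edge_sums E n)"
proof -
  obtain j where n: "n = j + 2" using n by (metis add.commute le_Suc_ex)
  have ok: "box_certificate 4 [(0, 1), (1, 2), (2, 3)] 2 [1, 2, 2, 1] path4_box" by code_simp
  show ?thesis
    unfolding n
  proof (rule not_orderable_edge_sums[OF unorderable_path4_box ok d, where a = 1 and b = 2])
    show "edges_of E [a, b, c, d] [(0, 1), (1, 2), (2, 3)]" using e by (simp add: edges_of_def)
    fix m assume m: "m \<in> edge_sums E (j + 2)" "\<forall>v. v \<notin> set [a, b, c, d] \<longrightarrow> lookup m v = 0"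
    assume "\<forall>i<4. lookup m ([a, b, c, d] ! i) \<le> (if i = 1 \<or> i = 2 then j else 0) + [1, 2, 2, 1] ! i"
    then have "lookup m a = 0 \<or> lookup m a = 1" "lookup m d = 0 \<or> lookup m d = 1"
      by (auto simp: all_less_4)
    moreover have "lookup m a + lookup m c \<le> j + 2" "lookup m b + lookup m d \<le> j + 2"
      using independent_pair[OF E m(1)] ne d by auto
    moreover have "lookup m a + lookup m b + lookup m c + lookup m d = 2 * j + 4"
      using degree_supported[OF E m d] by simp
    ultimately show "\<exists>xs\<in>set path4_box. \<forall>i<4.
       lookup m ([a, b, c, d] ! i) = (if i = 1 \<or> i = 2 then j else 0) + xs ! i"
      unfolding path4_box_def all_less_4 by (-, (elim disjE conjE; simp; arith?))
  qed simp_all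
qed

lemma paw_not_orderable:
  assumes E: "simple_graph E" and n: "n \<ge> 2" and d: "distinct [a, b, c, d]"
    and e: "{a, b} \<in> E" "{b, c} \<in> E" "{a, c} \<in> E" "{c, d} \<in> E" and ne: "{a, d} \<notin> E" "{b, d} \<notin> E"
  shows "\<not> orderable (edge_sums E n)"
proof -
  obtain j where n: "n = j + 2" using n by (metis add.commute le_Suc_ex)
  have ok: "box_certificate 4 [(0, 1), (1, 2), (0, 2), (2, 3)] 2 [2, 1, 2, 2] paw_box" by code_simp
  show ?thesis
    unfolding n
  proof (rule not_orderable_edge_sums[OF unorderable_paw_box ok d, where a = 0 and b = 1])
    show "edges_of E [a, b, c, d] [(0, 1), (1, 2), (0, 2), (2, 3)]" using e by (simp add: edges_of_def)
    fix m assume m: "m \<in> edge_sums E (j + 2)" "\<forall>v. v \<notin> set [a, b, c, d] \<longrightarrow> lookup m v = 0"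
    assume "\<forall>i<4. lookup m ([a, b, c, d] ! i) \<le> (if i = 0 \<or> i = 1 then j else 0) + [2, 1, 2, 2] ! i"
    then have "lookup m b \<le> j + 1"
      "lookup m c = 0 \<or> lookup m c = 1 \<or> lookup m c = 2" "lookup m d = 0 \<or> lookup m d = 1 \<or> lookup m d = 2"
      by (auto simp: all_less_4)
    moreover have "lookup m a + lookup m d \<le> j + 2" "lookup m b + lookup m d \<le> j + 2"
      using independent_pair[OF E m(1)] ne d by auto
    moreover have "lookup m a + lookup m b + lookup m c + lookup m d = 2 * j + 4"
      using degree_supported[OF E m d] by simp
    ultimately show "\<exists>xs\<in>set paw_box. \<forall>i<4.
       lookup m ([a, b, c, d] ! i) = (if i = 0 \<or> i = 1 then j else 0) + xs ! i"
      unfolding paw_box_def all_less_4 by (-, (elim disjE conjE; simp; arith?))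
  qed simp_all
qed

text \<open>
  The bound on the exponents of \<open>c\<close> and \<open>d\<close> leaves only vectors that are sums of edges of the diamond
  itself, whether or not \<open>{c, d}\<close> is an edge; so this covers complete graphs as well.
\<close>

lemma diamond_not_orderable:
  assumes E: "simple_graph E" and n: "n \<ge> 2" and d: "distinct [a, b, c, d]"
    and e: "{a, b} \<in> E" "{a, c} \<in> E" "{a, d} \<in> E" "{b, c} \<in> E" "{b, d} \<in> E"
  shows "\<not> orderable (edge_sums E n)"
proof -
  obtain j where n: "n = j + 2" using n by (metis add.commute le_Suc_ex)
  have ok: "box_certificate 4 [(0, 1), (0, 2), (0, 3), (1, 2), (1, 3)] 2 [2, 2, 1, 1] diamond_box" by code_simp
  show ?thesis
    unfolding n
  proof (rule not_orderable_edge_sums[OF unorderable_diamond_box ok d, where a = 0 and b = 1])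
    show "edges_of E [a, b, c, d] [(0, 1), (0, 2), (0, 3), (1, 2), (1, 3)]"
      using e by (simp add: edges_of_def)
    fix m assume m: "m \<in> edge_sums E (j + 2)" "\<forall>v. v \<notin> set [a, b, c, d] \<longrightarrow> lookup m v = 0"
    assume "\<forall>i<4. lookup m ([a, b, c, d] ! i) \<le> (if i = 0 \<or> i = 1 then j else 0) + [2, 2, 1, 1] ! i"
    then have "lookup m c = 0 \<or> lookup m c = 1" "lookup m d = 0 \<or> lookup m d = 1"
      by (auto simp: all_less_4)
    moreover have "lookup m a \<le> j + 2" "lookup m b \<le> j + 2"
      using lookup_edge_sums_le[OF E m(1)] by auto
    moreover have "lookup m a + lookup m b + lookup m c + lookup m d = 2 * j + 4"
      using degree_supported[OF E m d] by simp
    ultimately show "\<exists>xs\<in>set diamond_box. \<forall>i<4.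
       lookup m ([a, b, c, d] ! i) = (if i = 0 \<or> i = 1 then j else 0) + xs ! i"
      unfolding diamond_box_def all_less_4 by (-, (elim disjE conjE; simp; arith?))
  qed simp_all
qed

text \<open>
  The exponent of the centre is \<open>n\<close>, so the generators are the monomials of degree \<open>n\<close> in the leaves.
  Exponents at most \<open>2\<close> at two of the leaves are available in all combinations only if \<open>n \<ge> 4\<close>.
\<close>

lemma star_not_orderable:
  assumes E: "simple_graph E" and n: "n \<ge> 2" and d: "distinct [x, a, b, c]"
    and e: "{x, a} \<in> E" "{x, b} \<in> E" "{x, c} \<in> E" and ne: "{a, b} \<notin> E" "{a, c} \<notin> E" "{b, c} \<notin> E"
  shows "\<not> orderable (edge_sums E n)"
proof -
  have es: "edges_of E [x, a, b, c] [(0, 1), (0, 2), (0, 3)]" using e by (simp add: edges_of_def)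
  have exps: "lookup m x = n \<and> lookup m a + lookup m b + lookup m c = n"
    if m: "m \<in> edge_sums E n" "\<forall>v. v \<notin> set [x, a, b, c] \<longrightarrow> lookup m v = 0" for m
  proof -
    have "lookup m x \<le> n" using lookup_edge_sums_le[OF E m(1)] .
    moreover have "lookup m a + lookup m b + lookup m c \<le> n"
      using independent_triple[OF E m(1) _ ne] d by auto
    moreover have "lookup m x + lookup m a + lookup m b + lookup m c = 2 * n"
      using degree_supported[OF E m d] by simp
    ultimately show ?thesis by linarith
  qed
  consider "n = 0 + 2" | "n = 0 + 3" | j where "n = j + 4"
  proof -
    have "n = 2 \<or> n = 3 \<or> 4 \<le> n" using n by arith
    then show ?thesis using that le_Suc_ex[of 4 n] by (auto simp: add.commute)
  qed
  then show ?thesis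
  proof cases
    case 1
    have ok: "box_certificate 4 [(0, 1), (0, 2), (0, 3)] 2 [2, 2, 2, 2] star_box2" by code_simp
    show ?thesis
      unfolding 1
    proof (rule not_orderable_edge_sums[OF unorderable_star_box2 ok d _ _ es, where a = 0 and b = 1])
      fix m assume m: "m \<in> edge_sums E (0 + 2)" "\<forall>v. v \<notin> set [x, a, b, c] \<longrightarrow> lookup m v = 0"
      have "lookup m x = 2 \<and> lookup m a + lookup m b + lookup m c = 2" using exps[unfolded 1, OF m] by simp
      moreover then have "lookup m b = 0 \<or> lookup m b = 1 \<or> lookup m b = 2"
        "lookup m c = 0 \<or> lookup m c = 1 \<or> lookup m c = 2" by auto
      ultimately show "\<exists>xs\<in>set star_box2. \<forall>i<4.
         lookup m ([x, a, b, c] ! i) = (if i = 0 \<or> i = 1 then 0 else 0) + xs ! i"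
        unfolding star_box2_def all_less_4 by (-, (elim disjE conjE; simp; arith?))
    qed simp_all
  next
    case 2
    have ok: "box_certificate 4 [(0, 1), (0, 2), (0, 3)] 3 [3, 3, 2, 2] star_box3" by code_simp
    show ?thesis
      unfolding 2
    proof (rule not_orderable_edge_sums[OF unorderable_star_box3 ok d _ _ es, where a = 0 and b = 1])
      fix m assume m: "m \<in> edge_sums E (0 + 3)" "\<forall>v. v \<notin> set [x, a, b, c] \<longrightarrow> lookup m v = 0"
      assume "\<forall>i<4. lookup m ([x, a, b, c] ! i) \<le> (if i = 0 \<or> i = 1 then 0 else 0) + [3, 3, 2, 2] ! i"
      then have "lookup m b = 0 \<or> lookup m b = 1 \<or> lookup m b = 2" "lookup m c = 0 \<or> lookup m c = 1 \<or> lookup m c = 2"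
        by (auto simp: all_less_4)
      moreover have "lookup m x = 3 \<and> lookup m a + lookup m b + lookup m c = 3"
        using exps[unfolded 2, OF m] by simp
      ultimately show "\<exists>xs\<in>set star_box3. \<forall>i<4.
         lookup m ([x, a, b, c] ! i) = (if i = 0 \<or> i = 1 then 0 else 0) + xs ! i"
        unfolding star_box3_def all_less_4 by (-, (elim disjE conjE; simp; arith?))
    qed simp_all
  next
    case (3 j)
    have ok: "box_certificate 4 [(0, 1), (0, 2), (0, 3)] 4 [4, 4, 2, 2] star_box4" by code_simp
    show ?thesis
      unfolding 3
    proof (rule not_orderable_edge_sums[OF unorderable_star_box4 ok d _ _ es, where a = 0 and b = 1])
      fix m assume m: "m \<in> edge_sums E (j + 4)" "\<forall>v. v \<notin> set [x, a, b, c] \<longrightarrow> lookup m v = 0"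
      assume "\<forall>i<4. lookup m ([x, a, b, c] ! i) \<le> (if i = 0 \<or> i = 1 then j else 0) + [4, 4, 2, 2] ! i"
      then have "lookup m b = 0 \<or> lookup m b = 1 \<or> lookup m b = 2" "lookup m c = 0 \<or> lookup m c = 1 \<or> lookup m c = 2"
        by (auto simp: all_less_4)
      moreover have "lookup m x = j + 4 \<and> lookup m a + lookup m b + lookup m c = j + 4"
        using exps[unfolded 3, OF m] by simp
      ultimately show "\<exists>xs\<in>set star_box4. \<forall>i<4.
         lookup m ([x, a, b, c] ! i) = (if i = 0 \<or> i = 1 then j else 0) + xs ! i"
        unfolding star_box4_def all_less_4 by (-, (elim disjE conjE; simp; arith?))
    qed simp_all
  qed
qed

lemma triangle_exponents:
  assumes E: "simple_graph E" and d: "distinct [a, b, c]" and U: "UNIV = {a, b, c}" and m: "m \<in> edge_sums E n"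
  shows "lookup m a \<le> n \<and> lookup m b \<le> n \<and> lookup m c \<le> n \<and> lookup m a + lookup m b + lookup m c = 2 * n"
proof -
  have "\<forall>v. v \<notin> set [a, b, c] \<longrightarrow> lookup m v = 0" using U by auto
  from degree_supported[OF E m this d] show ?thesis using lookup_edge_sums_le[OF E m] by simp
qed

lemma mem_triangle_box:
  assumes "x \<le> 4" "y \<le> 4" "z \<le> 4" "x + y + z = 8"
  shows "[x, y, z] \<in> set triangle_box"
proof -
  have "x = 0 \<or> x = 1 \<or> x = 2 \<or> x = 3 \<or> x = 4" "y = 0 \<or> y = 1 \<or> y = 2 \<or> y = 3 \<or> y = 4"
    using assms(1,2) by arith+
  moreover have "z = 8 - x - y" "z \<le> 4" "4 \<le> x + y" using assms by auto
  ultimately show ?thesis unfolding triangle_box_def by (elim disjE) simp_all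
qed

text \<open>
  The exponent of \<open>a\<close> at most \<open>4\<close> forces those of \<open>b\<close> and \<open>c\<close> to be at least \<open>n - 4\<close>, so that
  a power of the edge \<open>{b, c}\<close> can be split off.
\<close>

lemma triangle_not_orderable:
  assumes E: "simple_graph E" and n: "n \<ge> 4" and d: "distinct [a, b, c]" and U: "UNIV = {a, b, c}"
    and e: "{a, b} \<in> E" "{b, c} \<in> E" "{a, c} \<in> E"
  shows "\<not> orderable (edge_sums E n)"
proof -
  obtain j where n: "n = j + 4" using n by (metis add.commute le_Suc_ex)
  have ok: "box_certificate 3 [(0, 1), (1, 2), (0, 2)] 4 [4, 4, 4] triangle_box" by code_simp
  show ?thesis
    unfolding n
  proof (rule not_orderable_edge_sums[OF unorderable_triangle_box ok d, where a = 1 and b = 2])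
    show "edges_of E [a, b, c] [(0, 1), (1, 2), (0, 2)]" using e by (simp add: edges_of_def)
    fix m assume m: "m \<in> edge_sums E (j + 4)"
    assume "\<forall>i<3. lookup m ([a, b, c] ! i) \<le> (if i = 1 \<or> i = 2 then j else 0) + [4, 4, 4] ! i"
    then have a4: "lookup m a \<le> 4" by (simp add: all_less_3)
    have s: "lookup m b \<le> j + 4" "lookup m c \<le> j + 4" "lookup m a + lookup m b + lookup m c = 2 * j + 8"
      using triangle_exponents[OF E d U m] by simp_all
    have "j \<le> lookup m b" "j \<le> lookup m c" using s a4 by linarith+
    then obtain y z where yz: "lookup m b = j + y" "lookup m c = j + z" using le_Suc_ex by metis
    have "[lookup m a, y, z] \<in> set triangle_box" using a4 s yz by (intro mem_triangle_box) simp_all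
    then show "\<exists>xs\<in>set triangle_box. \<forall>i<3.
       lookup m ([a, b, c] ! i) = (if i = 1 \<or> i = 2 then j else 0) + xs ! i"
      unfolding all_less_3 by (rule bexI[rotated]) (simp add: yz)
  qed simp_all
qed

section \<open>Graphs whose powers are bridge-friendly\<close>

lemma edge_orderable:
  assumes "n > 0" and d: "a \<noteq> b" and U: "(UNIV :: 'v::finite set) = {a, b}" and E: "E = {{a, b}}"
  shows "orderable (edge_sums E n)"
proof (rule orderable_if_injective_or_constant[OF finite_edge_sums])
  have E2: "simple_graph E" using E d by (simp add: simple_graph_def)
  show "0 \<notin> edge_sums E n" using degree_edge_sums[OF E2, of 0 n] assms(1) by auto
  fix v :: 'v
  have "lookup m v = n" if "m \<in> edge_sums E n" for m
    using sum_lookup_edge_sums_eq[OF that, of "{v}" 1] U E by auto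
  then show "(\<forall>m\<in>edge_sums E n. \<forall>m'\<in>edge_sums E n. lookup m v = lookup m' v)
      \<or> inj_on (\<lambda>m. lookup m v) (edge_sums E n)" by simp
qed

text \<open>
  The exponent of the middle vertex is \<open>n\<close>, and those of the two ends add up to \<open>n\<close>.
\<close>

lemma path_orderable:
  assumes n: "n > 0" and d: "distinct [a, b, c]" and U: "(UNIV :: 'v::finite set) = {a, b, c}"
    and E: "E = {{a, b}, {b, c}}"
  shows "orderable (edge_sums E n)"
proof (rule orderable_if_injective_or_constant[OF finite_edge_sums])
  have E2: "simple_graph E" using E d by (simp add: simple_graph_def)
  show "0 \<notin> edge_sums E n" using degree_edge_sums[OF E2, of 0 n] n by auto
  have "card (e \<inter> {b}) = 1" "card (e \<inter> {a, c}) = 1" if "e \<in> E" for e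
    using that E d by (auto simp: Int_insert_right)
  then have mid: "lookup m b = n" and ends: "lookup m a + lookup m c = n" if "m \<in> edge_sums E n" for m
    using sum_lookup_edge_sums_eq[OF that, of "{b}" 1] sum_lookup_edge_sums_eq[OF that, of "{a, c}" 1] d
    by auto
  have ext: "m = m'" if "lookup m a = lookup m' a" "lookup m b = lookup m' b" "lookup m c = lookup m' c"
    for m m' :: "'v monomial"
  proof (rule poly_mapping_eqI)
    fix v show "lookup m v = lookup m' v" using that U by (metis UNIV_I empty_iff insertE)
  qed
  fix v :: 'v
  have "v = b \<or> v = a \<or> v = c" using U by blast
  then show "(\<forall>m\<in>edge_sums E n. \<forall>m'\<in>edge_sums E n. lookup m v = lookup m' v)
      \<or> inj_on (\<lambda>m. lookup m v) (edge_sums E n)"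
  proof
    assume "v = b"
    then show ?thesis using mid by simp
  next
    assume v: "v = a \<or> v = c"
    have "inj_on (\<lambda>m. lookup m v) (edge_sums E n)"
    proof (rule inj_onI)
      fix m m' assume m: "m \<in> edge_sums E n" "m' \<in> edge_sums E n" "lookup m v = lookup m' v"
      then have "lookup m a = lookup m' a" "lookup m c = lookup m' c"
        using v ends[OF m(1)] ends[OF m(2)] by auto
      then show "m = m'" using ext mid m by simp
    qed
    then show ?thesis by blast
  qed
qed

text \<open>
  Any order on the third power whose first element is the central vector \<open>[2, 2, 2]\<close> leaves few sets to
  examine: at each vertex only three generators have an exponent smaller than \<open>2\<close>. The second power
  has no such centre, and a generator with a square at only one vertex takes this role.
\<close>

definition triangle_order2 :: "nat list list" where
  "triangle_order2 = [[1, 1, 2], [0, 2, 2], [1, 2, 1], [2, 0, 2], [2, 1, 1], [2, 2, 0]]"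

definition triangle_order3 :: "nat list list" where
  "triangle_order3 = [[2, 2, 2], [1, 2, 3], [0, 3, 3], [1, 3, 2], [2, 1, 3], [2, 3, 1], [3, 0, 3],
     [3, 1, 2], [3, 2, 1], [3, 3, 0]]"

lemma friendly_as_listed_triangle_order2: "friendly_as_listed triangle_order2"
  by code_simp

lemma friendly_as_listed_triangle_order3: "friendly_as_listed triangle_order3"
  by code_simp

lemma triangle_orderable_if_friendly_as_listed:
  assumes E: "simple_graph E" and d: "distinct [a, b, c]" and U: "UNIV = {a, b, c}"
    and e: "{a, b} \<in> E" "{b, c} \<in> E" "{a, c} \<in> E"
    and ok: "friendly_as_listed L" "box_certificate 3 [(0, 1), (1, 2), (0, 2)] n ub L"
    and mem: "\<And>x y z. x \<le> n \<Longrightarrow> y \<le> n \<Longrightarrow> z \<le> n \<Longrightarrow> x + y + z = 2 * n \<Longrightarrow> [x, y, z] \<in> set L"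
  shows "orderable (edge_sums E n)"
proof (rule orderable_if_friendly_as_listed[OF ok(1) d])
  have L: "length xs = 3" "xs \<in> set (edge_vec_sums 3 [(0, 1), (1, 2), (0, 2)] n)" if "xs \<in> set L" for xs
    using ok(2) that unfolding box_certificate_def list_all_iff List.member_iff by auto
  show "length xs = length [a, b, c]" if "xs \<in> set L" for xs using L(1)[OF that] by simp
  show "distinct L" using ok(2) unfolding box_certificate_def by simp
  have es: "edges_of E [a, b, c] [(0, 1), (1, 2), (0, 2)]" using e by (simp add: edges_of_def)
  show "edge_sums E n = mon [a, b, c] ` set L"
  proof
    show "mon [a, b, c] ` set L \<subseteq> edge_sums E n"
    proof
      fix m assume "m \<in> mon [a, b, c] ` set L"
      then obtain xs where xs: "xs \<in> set L" "m = mon [a, b, c] xs" by blast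
      have "length [a, b, c] = 3" by simp
      then show "m \<in> edge_sums E n" using mon_edge_vec_sums[OF d es] L(2)[OF xs(1)] xs(2) by metis
    qed
    show "edge_sums E n \<subseteq> mon [a, b, c] ` set L"
    proof
      fix m assume m: "m \<in> edge_sums E n"
      have "m = mon [a, b, c] [lookup m a, lookup m b, lookup m c]"
      proof (rule mon_eqI[OF d])
        show "lookup m v = 0" if "v \<notin> set [a, b, c]" for v using that U by auto
        show "lookup m ([a, b, c] ! k) = [lookup m a, lookup m b, lookup m c] ! k" if "k < length [a, b, c]" for k
          using that by (auto simp: less_Suc_eq)
      qed
      moreover have "[lookup m a, lookup m b, lookup m c] \<in> set L"
        using triangle_exponents[OF E d U m] by (intro mem) simp_all
      ultimately show "m \<in> mon [a, b, c] ` set L" by blast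
    qed
  qed
qed simp

lemma triangle_orderable:
  assumes E: "simple_graph E" and d: "distinct [a, b, c]" and U: "UNIV = {a, b, c}"
    and e: "{a, b} \<in> E" "{b, c} \<in> E" "{a, c} \<in> E" and n: "n \<in> {2, 3}"
  shows "orderable (edge_sums E n)"
proof -
  have ok2: "box_certificate 3 [(0, 1), (1, 2), (0, 2)] 2 [2, 2, 2] triangle_order2" by code_simp
  have ok3: "box_certificate 3 [(0, 1), (1, 2), (0, 2)] 3 [3, 3, 3] triangle_order3" by code_simp
  have mem2: "[x, y, z] \<in> set triangle_order2" if "x \<le> 2" "y \<le> 2" "z \<le> 2" "x + y + z = 2 * 2" for x y z
  proof -
    have "x = 0 \<or> x = 1 \<or> x = 2" "y = 0 \<or> y = 1 \<or> y = 2" "z = 4 - x - y" "z \<le> 2" "2 \<le> x + y"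
      using that by arith+
    then show ?thesis unfolding triangle_order2_def by (elim disjE) simp_all
  qed
  have mem3: "[x, y, z] \<in> set triangle_order3" if "x \<le> 3" "y \<le> 3" "z \<le> 3" "x + y + z = 2 * 3" for x y z
  proof -
    have "x = 0 \<or> x = 1 \<or> x = 2 \<or> x = 3" "y = 0 \<or> y = 1 \<or> y = 2 \<or> y = 3" "z = 6 - x - y" "z \<le> 3" "3 \<le> x + y"
      using that by arith+
    then show ?thesis unfolding triangle_order3_def by (elim disjE) simp_all
  qed
  show ?thesis
    using n triangle_orderable_if_friendly_as_listed[OF E d U e friendly_as_listed_triangle_order2 ok2 mem2]
      triangle_orderable_if_friendly_as_listed[OF E d U e friendly_as_listed_triangle_order3 ok3 mem3] by auto
qed

section \<open>Connected graphs\<close>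

lemma crossing_edge:
  assumes "connected_graph E" "x \<in> S" "y \<notin> S"
  obtains u v where "u \<in> S" "v \<notin> S" "{u, v} \<in> E"
proof -
  have "(x, y) \<in> {(x, y). {x, y} \<in> E}\<^sup>*" using assms(1) unfolding connected_graph_def by blast
  then have "\<exists>u v. u \<in> S \<and> v \<notin> S \<and> {u, v} \<in> E"
    using assms(3)
  proof (induction rule: rtrancl_induct)
    case base
    then show ?case using assms(2) by blast
  next
    case (step y z)
    then show ?case by (cases "y \<in> S") auto
  qed
  then show ?thesis using that by blast
qed


text \<open>
  If \<open>{a, c}\<close> is not an edge, the neighbours of \<open>d\<close> decide between a path or 4-cycle, a star, a paw and
  a diamond. If it is one, then \<open>a\<close>, \<open>b\<close>, \<open>c\<close> form a triangle, and \<open>d\<close> completes it to a paw when it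
  has one neighbour in it and to a diamond otherwise.
\<close>

lemma four_vertices_not_orderable:
  assumes E: "simple_graph E" and n: "n \<ge> 2" and d: "distinct [a, b, c, d]"
    and e: "{a, b} \<in> E" "{b, c} \<in> E" and de: "{a, d} \<in> E \<or> {b, d} \<in> E \<or> {c, d} \<in> E"
  shows "\<not> orderable (edge_sums E n)"
proof -
  note P = path4_not_orderable[OF E n] and S = star_not_orderable[OF E n]
    and W = paw_not_orderable[OF E n] and D = diamond_not_orderable[OF E n]
  have swap: "{b, a} = {a, b}" "{c, a} = {a, c}" "{d, a} = {a, d}" "{c, b} = {b, c}" "{d, b} = {b, d}" "{d, c} = {c, d}"
    by auto
  show ?thesis
  proof (cases "{a, c} \<in> E")
    case False
    then show ?thesis
      using d e de P[of a b c d] P[of d a b c] S[of b a c d] W[of a d b c] W[of c d b a] D[of b d a c]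
      unfolding swap by auto
  next
    case True
    then show ?thesis
      using d e de W[of b c a d] W[of a c b d] W[of a b c d] D[of a b c d] D[of a c b d] D[of b c a d]
      unfolding swap by auto
  qed
qed

text \<open>
  For the necessity of the condition, an edge is extended to a connected set of three and then of four
  vertices, as long as the graph has further vertices.
\<close>

theorem theorem4p15:
  fixes E :: "'v::finite set set" and n :: nat
  assumes "simple_graph E" and "connected_graph E" and "E \<noteq> {}" and "n \<ge> 2"
  shows "bridge_friendly (ideal_power (edge_ideal E :: ('v, 'k::field) mpoly set) n) \<longleftrightarrow>
           (is_edge_graph E \<or> is_path_length2 E) \<or> (n \<in> {2, 3} \<and> is_triangle E)"
proof -
  note E = assms(1) and conn = assms(2) and n = assms(4)
  have iff: "bridge_friendly (ideal_power (edge_ideal E :: ('v, 'k) mpoly set) n) \<longleftrightarrow> orderable (edge_sums E n)"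
    using n by (intro bridge_friendly_iff_orderable[OF E]) simp
  have "(is_edge_graph E \<or> is_path_length2 E) \<or> (n \<in> {2, 3} \<and> is_triangle E)"
    if o: "orderable (edge_sums E n)"
  proof -
    have pair: "\<exists>x y. x \<noteq> y \<and> e = {x, y}" if "e \<in> E" for e
      using that E unfolding simple_graph_def by (meson card_2_iff)
    obtain a b where ab: "a \<noteq> b" "{a, b} \<in> E" using assms(3) pair by blast
    show ?thesis
    proof (cases "UNIV = {a, b}")
      case True
      have "e = {a, b}" if "e \<in> E" for e
        using pair[OF that] True by (metis UNIV_I doubleton_eq_iff empty_iff insertE)
      then have "E = {{a, b}}" using ab(2) by blast
      then show ?thesis using ab(1) True unfolding is_edge_graph_def by auto
    next
      case False
      then obtain c0 where "c0 \<notin> {a, b}" by blast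
      then obtain u c where uc: "u \<in> {a, b}" "c \<notin> {a, b}" "{u, c} \<in> E"
        using crossing_edge[OF conn, of a "{a, b}"] by blast
      obtain p q where pq: "distinct [p, q, c]" "{p, q} \<in> E" "{q, c} \<in> E"
      proof (cases "u = b")
        case True
        then show ?thesis using that[of a b] uc ab by auto
      next
        case False
        then show ?thesis using that[of b a] uc ab by (auto simp: insert_commute)
      qed
      show ?thesis
      proof (cases "UNIV = {p, q, c}")
        case True
        have sub: "E \<subseteq> {{p, q}, {q, c}, {p, c}}"
        proof
          fix e assume "e \<in> E"
          from pair[OF this] obtain x y where "x \<noteq> y" "e = {x, y}" by blast
          moreover have "x \<in> {p, q, c}" "y \<in> {p, q, c}" using True by blast+
          ultimately show "e \<in> {{p, q}, {q, c}, {p, c}}" by auto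
        qed
        show ?thesis
        proof (cases "{p, c} \<in> E")
          case pc: True
          then have "E = {{p, q}, {q, c}, {c, p}}" using sub pq by (auto simp: insert_commute)
          then have "is_triangle E" using pq(1) True unfolding is_triangle_def by blast
          moreover have "\<not> n \<ge> 4"
            using triangle_not_orderable[OF E _ pq(1) True pq(2,3) pc] o by blast
          then have "n \<in> {2, 3}" using n by auto
          ultimately show ?thesis by blast
        next
          case pc: False
          then have "E = {{p, q}, {q, c}}" using sub pq by auto
          then have "is_path_length2 E" using pq(1) True unfolding is_path_length2_def by blast
          then show ?thesis by blast
        qed
      next
        case False
        then obtain d0 where "d0 \<notin> {p, q, c}" by blast
        then obtain v d where vd: "v \<in> {p, q, c}" "d \<notin> {p, q, c}" "{v, d} \<in> E"
          using crossing_edge[OF conn, of p "{p, q, c}"] by blast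
        then have "distinct [p, q, c, d]" "{p, d} \<in> E \<or> {q, d} \<in> E \<or> {c, d} \<in> E" using pq(1) by auto
        then show ?thesis using four_vertices_not_orderable[OF E n _ pq(2,3)] o by blast
      qed
    qed
  qed
  moreover have "orderable (edge_sums E n)" if "is_edge_graph E"
    using that n edge_orderable[of n _ _ E] unfolding is_edge_graph_def by auto
  moreover have "orderable (edge_sums E n)" if "is_path_length2 E"
    using that n path_orderable[of n _ _ _ E] unfolding is_path_length2_def by fastforce
  moreover have "orderable (edge_sums E n)" if n23: "n \<in> {2, 3}" and tri: "is_triangle E"
  proof -
    obtain a b c where abc: "distinct [a, b, c]" "UNIV = {a, b, c}" "E = {{a, b}, {b, c}, {c, a}}"
      using tri unfolding is_triangle_def by blast
    then have "{a, b} \<in> E" "{b, c} \<in> E" "{a, c} \<in> E" by (auto simp: insert_commute)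
    then show ?thesis using triangle_orderable[OF E abc(1,2) _ _ _ n23] by blast
  qed
  ultimately show ?thesis unfolding iff by blast
qed

end
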